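(* Let $n$ be a positive integer, and let $c_0, c_0'$ and $c_a, c_a'$ (for $a \in A_+$) be elements of $\mathbb{C}_\infty$. Suppose that, as formal power series in $t$, \[ c_0+\sum_{a\in A_+}c_a\,G_n(t_a)=c_0'+\sum_{a\in A_+}c_a'\,G_n(t_a). \] Then $c_a=c_a'$ for all $a\in A_+\cup\{0\}$.
   Context: Let $q$ be a prime power, $A=\mathbb{F}_q[T]$, and $A_+$ the set of monic elements of $A$. Let $\mathbb{C}_\infty$ be the completion of an algebraic closure of $\mathbb{F}_q((1/T))$. Fix a period $\widetilde{\pi}$ of the Carlitz module, and let $e_{\widetilde{\pi}A}(z)=z\prod_{0\neq\lambda\in\widetilde{\pi}A}(1-z/\lambda)$ be the Carlitz exponential. Put $t=t(z)=1/e_{\widetilde{\pi}A}(\widetilde{\pi}z)$ and $t_a=t(az)$. Each $t_a$ is a power series in $t$ of the form $t^{q^{\deg a}}+(\text{higher order terms})$. $G_n(X)$ is the $n$-th Goss polynomial of the lattice $\widetilde{\pi}A$, i.e. the polynomial with $G_n(t(z))=\sum_{b\in A}(\widetilde{\pi}z+\widetilde{\pi}b)^{-n}$. It is divisible by $X$. Both sides of the hypothesis are regarded as elements of $\mathbb{C}_\infty[[t]]$. They are well-defined formal series because $t_a$ has $t$-adic order $q^{\deg a}$. *)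

theory Defs
  imports
    "HOL-Algebra.Algebraic_Closure_Type"
    "HOL-Analysis.Analysis"
    "HOL-Computational_Algebra.Computational_Algebra"
begin

text \<open>
  The finite field \<open>\<F>\<^sub>q\<close> is a type \<open>'f :: {finite, field}\<close> with \<open>q = CARD('f)\<close>, and
  \<open>A = \<F>\<^sub>q[T]\<close> is \<open>'f poly\<close>. The field \<open>\<F>\<^sub>q((1/T))\<close> is \<open>'f fls\<close>, where the variable of the
  Laurent series stands for \<open>1/T\<close>, so that \<open>T\<close> is \<open>fls_X_inv\<close>.
\<close>

definition A_plus :: "'f::{finite,field} poly set" where
  "A_plus = {a. Polynomial.lead_coeff a = 1}"

text \<open>
  The absolute value of \<open>\<F>\<^sub>q((1/T))\<close>, normalised by \<open>|a| = q ^ deg a\<close> for nonzero \<open>a \<in> A\<close>.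
\<close>

definition abs_infty :: "'f::{finite,field} fls \<Rightarrow> real" where
  "abs_infty x = (if x = 0 then 0 else real CARD('f) powi (- fls_subdegree x))"

text \<open>
  A model of \<open>\<complex>\<^sub>\<infinity>\<close>: a field \<open>'c\<close>, complete for a nonarchimedean absolute value \<open>|x| = dist x 0\<close>,
  together with an embedding \<open>\<iota>\<close> with dense image of an algebraic closure of \<open>\<F>\<^sub>q((1/T))\<close>, such that
  the absolute value of \<open>'c\<close> extends that of \<open>\<F>\<^sub>q((1/T))\<close>. These data are unique up to isometric
  isomorphism. The normed-field classes of the library do not apply, since they are restricted to
  real algebras.
\<close>

locale C_infty =
  fixes \<iota> :: "'f::{finite,field} fls alg_closure \<Rightarrow> 'c::{field,complete_space}"
  assumes dist_diff: "dist x y = dist (x - y) (0::'c)"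
    and abs_mult: "dist (x * y) 0 = dist x 0 * dist y (0::'c)"
    and abs_add: "dist (x + y) 0 \<le> max (dist x 0) (dist y (0::'c))"
    and hom_add: "\<iota> (u + v) = \<iota> u + \<iota> v"
    and hom_mult: "\<iota> (u * v) = \<iota> u * \<iota> v"
    and hom_one: "\<iota> 1 = 1"
    and abs_extends: "dist (\<iota> (to_ac w)) 0 = abs_infty w"
    and dense: "closure (range \<iota>) = UNIV"

definition of_A ::
  "('f::{finite,field} fls alg_closure \<Rightarrow> 'c::{field,complete_space}) \<Rightarrow> 'f poly \<Rightarrow> 'c" where
  "of_A \<iota> a = \<iota> (to_ac (poly (map_poly fls_const a) fls_X_inv))"

text \<open>
  The unordered infinite product over \<open>\<Lambda> - {0}\<close> is the limit of the products over finite subsets.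
\<close>

definition lattice_exp :: "'c::{field,complete_space} set \<Rightarrow> 'c \<Rightarrow> 'c" where
  "lattice_exp \<Lambda> z =
     z * Lim (finite_subsets_at_top (\<Lambda> - {0})) (\<lambda>F. \<Prod>v\<in>F. 1 - z / v)"

definition lattice ::
  "('f::{finite,field} fls alg_closure \<Rightarrow> 'c::{field,complete_space}) \<Rightarrow> 'c \<Rightarrow> 'c set" where
  "lattice \<iota> \<pi> = (\<lambda>a. \<pi> * of_A \<iota> a) ` UNIV"

text \<open>
  The Carlitz module is the \<open>\<F>\<^sub>q\<close>-algebra homomorphism from \<open>A\<close> to the \<open>\<F>\<^sub>q\<close>-linear polynomial
  maps (under composition) that sends \<open>T\<close> to \<open>x \<mapsto> T x + x ^ q\<close>.
\<close>

definition carlitz ::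
  "('f::{finite,field} fls alg_closure \<Rightarrow> 'c::{field,complete_space}) \<Rightarrow> 'f poly \<Rightarrow> 'c \<Rightarrow> 'c" where
  "carlitz \<iota> a x =
     (\<Sum>i\<le>Polynomial.degree a. of_A \<iota> [:Polynomial.coeff a i:] *
        ((\<lambda>y. of_A \<iota> [:0, 1:] * y + y ^ CARD('f)) ^^ i) x)"

text \<open>
  \<open>\<pi>\<close> is a period of the Carlitz module if the Carlitz module is the Drinfeld module attached to the
  lattice \<open>\<pi>A\<close>.
\<close>

definition carlitz_period ::
  "('f::{finite,field} fls alg_closure \<Rightarrow> 'c::{field,complete_space}) \<Rightarrow> 'c \<Rightarrow> bool" where
  "carlitz_period \<iota> \<pi> \<longleftrightarrow> \<pi> \<noteq> 0 \<and>
     (\<forall>a z. lattice_exp (lattice \<iota> \<pi>) (of_A \<iota> a * z) =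
            carlitz \<iota> a (lattice_exp (lattice \<iota> \<pi>) z))"

text \<open>
  This has its intended meaning only for \<open>z \<notin> A\<close>: at the poles \<open>z \<in> A\<close> division by zero yields \<open>0\<close>.
\<close>

definition t_param ::
  "('f::{finite,field} fls alg_closure \<Rightarrow> 'c::{field,complete_space}) \<Rightarrow> 'c \<Rightarrow> 'c \<Rightarrow> 'c" where
  "t_param \<iota> \<pi> z = 1 / lattice_exp (lattice \<iota> \<pi>) (\<pi> * z)"

text \<open>
  \<open>P\<close> is the power series of \<open>t\<^sub>a = t(az)\<close> in \<open>t = t(z)\<close>, i.e. it represents \<open>t\<^sub>a\<close> for all \<open>z\<close> with \<open>|t(z)|\<close>
  sufficiently small. As \<open>t(z)\<close> takes arbitrarily small nonzero values, there is at most one such \<open>P\<close>.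
\<close>

definition is_t_expansion ::
  "('f::{finite,field} fls alg_closure \<Rightarrow> 'c::{field,complete_space}) \<Rightarrow> 'c \<Rightarrow> 'f poly \<Rightarrow> 'c fps \<Rightarrow> bool"
  where
  "is_t_expansion \<iota> \<pi> a P \<longleftrightarrow>
     (\<exists>r>0. \<forall>z. z \<notin> range (of_A \<iota>) \<and> dist (t_param \<iota> \<pi> z) 0 < r \<longrightarrow>
        (\<lambda>k. fps_nth P k * t_param \<iota> \<pi> z ^ k) sums t_param \<iota> \<pi> (of_A \<iota> a * z))"

text \<open>
  \<open>G\<close> is the \<open>n\<close>-th Goss polynomial of the lattice \<open>\<pi>A\<close>. As \<open>t(z)\<close> takes infinitely many values, there
  is at most one such \<open>G\<close>.
\<close>

definition is_goss_poly ::
  "('f::{finite,field} fls alg_closure \<Rightarrow> 'c::{field,complete_space}) \<Rightarrow> 'c \<Rightarrow> nat \<Rightarrow> 'c poly \<Rightarrow> bool"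
  where
  "is_goss_poly \<iota> \<pi> n G \<longleftrightarrow>
     (\<forall>z. z \<notin> range (of_A \<iota>) \<longrightarrow>
        ((\<lambda>b. 1 / (\<pi> * z + \<pi> * of_A \<iota> b) ^ n) has_sum poly G (t_param \<iota> \<pi> z)) UNIV)"

text \<open>
  The formal series \<open>c\<^sub>0 + \<Sum> c\<^sub>a G(t\<^sub>a)\<close> over monic \<open>a\<close>, where \<open>c\<^sub>0\<close> is \<open>c 0\<close>. The sum is taken in the
  topology of \<open>'c fps\<close>, which is the \<open>t\<close>-adic one and does not involve the topology of \<open>'c\<close>.
\<close>

definition A_expansion ::
  "('f::{finite,field} poly \<Rightarrow> 'c::field fps) \<Rightarrow> 'c poly \<Rightarrow> ('f poly \<Rightarrow> 'c) \<Rightarrow> 'c fps" where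
  "A_expansion t G c =
     fps_const (c 0) +
     (\<Sum>\<^sub>\<infinity>a\<in>A_plus. fps_const (c a) * poly (map_poly fps_const G) (t a))"

end

theory Submission
  imports Defs
begin

text \<open>
  By the functional equation of the Carlitz exponential, \<open>t\<^sub>a\<close> is an explicit rational function of \<open>t\<close>,
  and the formal translation \<open>z \<mapsto> z + h\<close> sends \<open>t\<^sub>a\<close> to \<open>t\<^sub>a / (1 + e(a h) t\<^sub>a)\<close>. Hence the coefficient
  of \<open>h\<^sup>j\<close> in the translate of \<open>G(t\<^sub>a)\<close> is \<open>a\<^sup>j Q\<^sub>j(t\<^sub>a)\<close> with a polynomial \<open>Q\<^sub>j\<close> independent of \<open>a\<close>, and any
  relation \<open>\<Sum> g\<^sub>a G(t\<^sub>a) = const\<close> yields \<open>\<Sum> g\<^sub>a a\<^sup>j Q\<^sub>j(t\<^sub>a) = 0\<close>. If \<open>Q\<^sub>j\<close> is not zero, then the lowest order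
  term gives \<open>\<Sum> g\<^sub>a a\<^sup>j = 0\<close>, the sum being over the monic \<open>a\<close> of minimal degree with \<open>g\<^sub>a \<noteq> 0\<close>. Comparing
  leading coefficients, \<open>Q\<^sub>j\<close> is not zero if \<open>j\<close> is a multiple of some \<open>q\<^sup>M \<ge> deg G\<close>, which suffices for a
  Vandermonde argument. Of the Goss polynomial one only needs \<open>G \<noteq> 0\<close> and \<open>G(0) = 0\<close>.
\<close>

section \<open>The formal Carlitz module\<close>

lemma finite_field_power_card:
  fixes x :: "'f::{finite,field}"
  shows "x ^ CARD('f) = x"
proof (cases "x = 0")
  case False
  let ?U = "UNIV - {0::'f}"
  \<comment> \<open>Multiplication by \<open>x\<close> permutes the nonzero elements; comparing
    their products gives \<open>x ^ (q - 1) = 1\<close>.\<close>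
  have "bij_betw ((*) x) ?U ?U"
  proof (rule bij_betwI[where g = "\<lambda>y. y / x"])
  qed (use False in auto)
  then have "(\<Prod>y\<in>?U. x * y) = (\<Prod>y\<in>?U. y)"
    by (rule prod.reindex_bij_betw)
  then have "x ^ card ?U * \<Prod>?U = \<Prod>?U"
    by (simp add: prod.distrib)
  moreover have "\<Prod>?U \<noteq> 0"
    by simp
  ultimately have "x ^ card ?U = 1"
    by simp
  moreover have "CARD('f) = Suc (card ?U)"
    by (simp add: card_Diff_singleton)
  ultimately show ?thesis
    by (metis power_Suc mult.right_neutral)
qed (simp add: finite_UNIV_card_ge_0)

lemma card_field_gt_1: "CARD('f::{finite,field}) > 1"
  using card_mono[of "UNIV :: 'f set" "{0, 1}"] by simp

text \<open>The polynomial \<open>(X + 1)\<^sup>q - X\<^sup>q - 1\<close> has degree less than \<open>q\<close> and vanishes on all of \<open>\<F>\<^sub>q\<close>.\<close>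

lemma of_nat_card_choose:
  assumes "0 < k" "k < CARD('f::{finite,field})"
  shows "of_nat (CARD('f) choose k) = (0::'f)"
proof -
  let ?q = "CARD('f)"
  define p :: "'f poly" where "p = [:1, 1:] ^ ?q - monom 1 ?q - 1"
  have q: "?q > 1"
    by (rule card_field_gt_1)
  have *: "Polynomial.coeff ([:1, 1:] ^ ?q) i = (of_nat (?q choose i) :: 'f)" if "i \<le> ?q" for i
    using coeff_linear_poly_power[of i ?q "1::'f" 1] that by simp
  have "Polynomial.degree p < ?q"
  proof (rule degree_lessI)
    show "p \<noteq> 0 \<or> 0 < ?q"
      using q by auto
    show "\<forall>i\<ge>?q. Polynomial.coeff p i = 0"
    proof (intro allI impI)
      fix i assume i: "?q \<le> i"
      show "Polynomial.coeff p i = 0"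
      proof (cases "i = ?q")
        case True
        then show ?thesis
          using q by (simp add: p_def *)
      next
        case False
        then have "Polynomial.coeff ([:1, 1:] ^ ?q) i = (0 :: 'f)"
          using i by (intro coeff_eq_0) (simp add: degree_linear_power)
        then show ?thesis
          using False i q by (simp add: p_def)
      qed
    qed
  qed
  moreover have "poly p x = 0" for x
    by (simp add: p_def poly_monom finite_field_power_card)
  ultimately have "p = 0"
    using card_poly_roots_bound[of p] by (cases "p = 0") auto
  then have "Polynomial.coeff p k = 0"
    by simp
  then show ?thesis
    using assms by (simp add: p_def *)
qed

lemma frobenius_add:
  fixes x y :: "'b::comm_ring_1"
  assumes choose: "\<And>k. \<lbrakk>0 < k; k < q\<rbrakk> \<Longrightarrow> of_nat (q choose k) = (0::'b)" and "q > 0"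
  shows "(x + y) ^ q = x ^ q + y ^ q"
proof -
  have "(x + y) ^ q = (\<Sum>k\<le>q. of_nat (q choose k) * x ^ k * y ^ (q - k))"
    by (rule binomial_ring)
  also have "\<dots> = (\<Sum>k\<in>{0, q}. of_nat (q choose k) * x ^ k * y ^ (q - k))"
    by (rule sum.mono_neutral_right) (use choose in auto)
  finally show ?thesis
    using \<open>q > 0\<close> by (simp add: add.commute)
qed

text \<open>The algebraic half of the proof sees the complete field only through this injective ring
  homomorphism on A; no topology enters.\<close>

locale poly_embedding =
  fixes \<rho> :: "'f::{finite,field} poly \<Rightarrow> 'c::field"
  assumes rho_add: "\<rho> (a + b) = \<rho> a + \<rho> b"
    and rho_mult: "\<rho> (a * b) = \<rho> a * \<rho> b"
    and rho_one: "\<rho> 1 = 1"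
    and rho_eq_0D: "\<rho> a = 0 \<Longrightarrow> a = 0"
begin

definition q :: nat where "q = CARD('f)"

definition T :: 'c where "T = \<rho> [:0, 1:]"

lemma q_gt_1: "q > 1"
  unfolding q_def by (rule card_field_gt_1)

lemma q_pos: "q > 0"
  using q_gt_1 by simp

lemma rho_0: "\<rho> 0 = 0"
  using rho_add[of 0 0] by (metis add.right_neutral add_cancel_left_right)

lemma rho_minus: "\<rho> (- a) = - \<rho> a"
  using rho_add[of a "- a"] by (simp add: rho_0 add_eq_0_iff)

lemma rho_diff: "\<rho> (a - b) = \<rho> a - \<rho> b"
  using rho_add[of a "- b"] by (simp add: rho_minus)

lemma rho_eq_iff: "\<rho> a = \<rho> b \<longleftrightarrow> a = b"
  using rho_eq_0D[of "a - b"] by (auto simp: rho_diff)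

lemma rho_sum: "\<rho> (sum f A) = (\<Sum>x\<in>A. \<rho> (f x))"
  by (induction A rule: infinite_finite_induct) (auto simp: rho_0 rho_add)

lemma rho_power: "\<rho> (a ^ n) = \<rho> a ^ n"
  by (induction n) (auto simp: rho_one rho_mult)

lemma rho_of_nat: "\<rho> (of_nat n) = of_nat n"
  by (induction n) (auto simp: rho_0 rho_one rho_add)

lemma rho_const_power: "\<rho> [:c:] ^ (q ^ i) = \<rho> [:c:]"
proof (induction i)
  case (Suc i)
  have "\<rho> [:c:] ^ q = \<rho> [:c:]"
    by (simp add: q_def finite_field_power_card poly_const_pow flip: rho_power)
  with Suc show ?case
    by (simp add: power_mult)
qed simp

lemma rho_eq_sum: "\<rho> a = (\<Sum>k\<le>Polynomial.degree a. \<rho> [:Polynomial.coeff a k:] * T ^ k)"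
proof -
  have "a = (\<Sum>k\<le>Polynomial.degree a. [:Polynomial.coeff a k:] * [:0, 1:] ^ k)"
    by (subst poly_as_sum_of_monoms[of a, symmetric])
       (simp add: monom_altdef)
  then have "\<rho> a = \<rho> (\<Sum>k\<le>Polynomial.degree a. [:Polynomial.coeff a k:] * [:0, 1:] ^ k)"
    by simp
  then show ?thesis
    by (simp only: rho_sum rho_mult rho_power T_def)
qed

text \<open>Keeps the denominators in the recursion of \<open>exp_coeff\<close> away from
  zero.\<close>

lemma T_power_neq: assumes "n > 1" shows "T ^ n \<noteq> T"
proof
  assume "T ^ n = T"
  then have "\<rho> (monom 1 n) = \<rho> (monom 1 1)"
    by (simp add: T_def monom_altdef rho_power)
  then have "monom (1::'f) n = monom 1 1"
    by (simp only: rho_eq_iff)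
  then have "Polynomial.degree (monom (1::'f) n) = Polynomial.degree (monom (1::'f) 1)"
    by simp
  then show False
    using assms by (simp add: degree_monom_eq)
qed

lemma of_nat_q_choose:
  assumes "0 < k" "k < q"
  shows "of_nat (q choose k) = (0::'c)"
proof -
  have "of_nat (CARD('f) choose k) = (0::'f poly)"
    using of_nat_card_choose[of k, where 'f='f] assms by (simp add: q_def of_nat_poly)
  then have "\<rho> (of_nat (q choose k)) = \<rho> 0"
    by (simp add: q_def)
  then show ?thesis
    by (simp only: rho_of_nat rho_0)
qed

text \<open>Additivity of the q-th power is recorded per ring, since it is used in the field itself
  and in power series over it in one and in two variables.\<close>

definition frobenius :: "'b::comm_ring_1 itself \<Rightarrow> bool" where
  "frobenius _ \<longleftrightarrow> (\<forall>x y :: 'b. (x + y) ^ q = x ^ q + y ^ q)"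

lemma frobeniusI:
  assumes "\<And>n. of_nat n = (0::'c) \<Longrightarrow> of_nat n = (0::'b::comm_ring_1)"
  shows "frobenius TYPE('b)"
  unfolding frobenius_def
proof (intro allI)
  fix x y :: 'b
  show "(x + y) ^ q = x ^ q + y ^ q"
    by (rule frobenius_add) (simp_all add: assms of_nat_q_choose q_pos)
qed

lemma frobenius_base: "frobenius TYPE('c)"
  by (rule frobeniusI)

lemma frobenius_fps: "frobenius TYPE('c fps)"
  by (rule frobeniusI) (simp add: fps_of_nat[symmetric])

lemma frobenius_fps_fps: "frobenius TYPE('c fps fps)"
  by (rule frobeniusI) (simp add: fps_of_nat[symmetric])

lemma power_q_add:
  assumes "frobenius TYPE('b::comm_ring_1)"
  shows "(x + y :: 'b) ^ q ^ i = x ^ q ^ i + y ^ q ^ i"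
proof (induction i)
  case (Suc i)
  have "(x + y) ^ q ^ Suc i = ((x + y) ^ q ^ i) ^ q"
    by (simp add: power_mult[symmetric] mult.commute)
  also have "\<dots> = x ^ q ^ Suc i + y ^ q ^ Suc i"
    using assms by (simp add: Suc frobenius_def power_mult[symmetric] mult.commute)
  finally show ?case .
qed simp

lemma power_q_sum:
  assumes "frobenius TYPE('b::comm_ring_1)"
  shows "(\<Sum>x\<in>A. f x :: 'b) ^ q ^ i = (\<Sum>x\<in>A. f x ^ q ^ i)"
  by (induction A rule: infinite_finite_induct) (use q_pos in \<open>auto simp: power_q_add[OF assms] power_0_left\<close>)

subsection \<open>Coefficients of the Carlitz module\<close>

text \<open>\<open>tau_coeff k i\<close> is the coefficient of \<open>tau ^ i\<close> in
  \<open>(T + tau) ^ k\<close>, where \<open>tau\<close> is the q-th power map and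
  \<open>tau x = x ^ q tau\<close>. The recursion is left multiplication by
  \<open>T + tau\<close>.\<close>

primrec tau_coeff :: "nat \<Rightarrow> nat \<Rightarrow> 'c" where
  "tau_coeff 0 = (\<lambda>i. if i = 0 then 1 else 0)"
| "tau_coeff (Suc k) = (\<lambda>i. T * tau_coeff k i + (if i = 0 then 0 else tau_coeff k (i - 1) ^ q))"

lemma tau_coeff_eq_0: "k < i \<Longrightarrow> tau_coeff k i = 0"
  by (induction k arbitrary: i) (auto simp: q_pos)

lemma tau_coeff_diag: "tau_coeff k k = 1"
  by (induction k) (auto simp: tau_coeff_eq_0)

text \<open>The Carlitz module sends \<open>a\<close> to \<open>x \<mapsto> \<Sum>\<^sub>i carlitz_coeff a i \<cdot> x ^ q ^ i\<close>.\<close>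

definition carlitz_coeff :: "'f poly \<Rightarrow> nat \<Rightarrow> 'c" where
  "carlitz_coeff a i = (\<Sum>k\<le>Polynomial.degree a. \<rho> [:Polynomial.coeff a k:] * tau_coeff k i)"

lemma carlitz_coeff_degree:
  assumes "a \<in> A_plus"
  shows "carlitz_coeff a (Polynomial.degree a) = 1"
proof -
  have "carlitz_coeff a (Polynomial.degree a) =
      (\<Sum>k\<in>{Polynomial.degree a}. \<rho> [:Polynomial.coeff a k:] * tau_coeff k (Polynomial.degree a))"
    unfolding carlitz_coeff_def by (rule sum.mono_neutral_right) (auto simp: tau_coeff_eq_0)
  then show ?thesis
    using assms by (simp add: A_plus_def tau_coeff_diag pCons_one rho_one)
qed

text \<open>The homomorphism \<open>\<eta>\<close> lets one computation serve both the field
  (\<open>\<eta>\<close> the identity) and the power series over it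
  (\<open>\<eta> = fps_const\<close>).\<close>

lemma tau_funpow:
  fixes \<eta> :: "'c \<Rightarrow> 'b::comm_ring_1"
  assumes "frobenius TYPE('b)"
    and add: "\<And>x y. \<eta> (x + y) = \<eta> x + \<eta> y" and mult: "\<And>x y. \<eta> (x * y) = \<eta> x * \<eta> y"
    and one: "\<eta> 1 = 1"
  shows "((\<lambda>y. \<eta> T * y + y ^ q) ^^ k) x = (\<Sum>i\<le>k. \<eta> (tau_coeff k i) * x ^ q ^ i)"
proof (induction k)
  case (Suc k)
  have zero: "\<eta> 0 = 0"
    using add[of 0 0] by (metis add.right_neutral add_cancel_left_right)
  have pow: "\<eta> (x ^ n) = \<eta> x ^ n" for x n
    by (induction n) (auto simp: one mult)
  have "(\<Sum>i\<le>k. \<eta> (tau_coeff k i) * x ^ q ^ i) ^ q =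
      (\<Sum>i\<le>k. \<eta> (tau_coeff k i ^ q) * x ^ q ^ Suc i)"
    using power_q_sum[OF assms(1), of "\<lambda>i. \<eta> (tau_coeff k i) * x ^ q ^ i" "{..k}" 1]
    by (simp add: pow power_mult_distrib power_mult[symmetric] mult.commute)
  also have "\<dots> = (\<Sum>i\<le>Suc k. (if i = 0 then 0 else \<eta> (tau_coeff k (i - 1) ^ q)) * x ^ q ^ i)"
    by (simp only: sum.atMost_Suc_shift) simp
  finally have frob: "(\<Sum>i\<le>k. \<eta> (tau_coeff k i) * x ^ q ^ i) ^ q = \<dots>" .
  have "\<eta> T * (\<Sum>i\<le>k. \<eta> (tau_coeff k i) * x ^ q ^ i) =
      (\<Sum>i\<le>Suc k. \<eta> T * \<eta> (tau_coeff k i) * x ^ q ^ i)"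
    by (simp add: sum_distrib_left mult.assoc tau_coeff_eq_0 zero)
  with frob show ?case
    unfolding funpow.simps o_apply Suc
    by (simp only: sum.distrib[symmetric])
       (auto intro!: sum.cong simp: add mult zero algebra_simps simp del: sum.atMost_Suc)
qed (simp add: one)

lemma carlitz_sum:
  fixes \<eta> :: "'c \<Rightarrow> 'b::comm_ring_1"
  assumes "frobenius TYPE('b)"
    and add: "\<And>x y. \<eta> (x + y) = \<eta> x + \<eta> y" and mult: "\<And>x y. \<eta> (x * y) = \<eta> x * \<eta> y"
    and one: "\<eta> 1 = 1"
  shows "(\<Sum>k\<le>Polynomial.degree a. \<eta> (\<rho> [:Polynomial.coeff a k:]) * ((\<lambda>y. \<eta> T * y + y ^ q) ^^ k) x) =
    (\<Sum>i\<le>Polynomial.degree a. \<eta> (carlitz_coeff a i) * x ^ q ^ i)"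
proof -
  let ?d = "Polynomial.degree a"
  have zero: "\<eta> 0 = 0"
    using add[of 0 0] by (metis add.right_neutral add_cancel_left_right)
  have sum: "\<eta> (sum f A) = (\<Sum>x\<in>A. \<eta> (f x))" for f and A :: "nat set"
    by (induction A rule: infinite_finite_induct) (auto simp: zero add)
  have "(\<Sum>k\<le>?d. \<eta> (\<rho> [:Polynomial.coeff a k:]) * ((\<lambda>y. \<eta> T * y + y ^ q) ^^ k) x) =
      (\<Sum>k\<le>?d. \<Sum>i\<le>?d. \<eta> (\<rho> [:Polynomial.coeff a k:]) * (\<eta> (tau_coeff k i) * x ^ q ^ i))"
  proof (rule sum.cong[OF refl])
    fix k assume "k \<in> {..?d}"
    then have "(\<Sum>i\<le>k. \<eta> (tau_coeff k i) * x ^ q ^ i) = (\<Sum>i\<le>?d. \<eta> (tau_coeff k i) * x ^ q ^ i)"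
      by (intro sum.mono_neutral_left) (auto simp: tau_coeff_eq_0 zero)
    then show "\<eta> (\<rho> [:Polynomial.coeff a k:]) * ((\<lambda>y. \<eta> T * y + y ^ q) ^^ k) x =
        (\<Sum>i\<le>?d. \<eta> (\<rho> [:Polynomial.coeff a k:]) * (\<eta> (tau_coeff k i) * x ^ q ^ i))"
      by (simp add: tau_funpow[OF assms] sum_distrib_left)
  qed
  also have "\<dots> = (\<Sum>i\<le>?d. \<eta> (carlitz_coeff a i) * x ^ q ^ i)"
    by (subst sum.swap) (simp add: carlitz_coeff_def sum mult sum_distrib_right mult.assoc)
  finally show ?thesis .
qed

subsection \<open>The formal Carlitz exponential\<close>

text \<open>Frobenius is additive on finite sums only, so \<open>f\<close> is cut after the
  coefficient \<open>n\<close>. The remainder is divisible by \<open>X ^ (n + 1)\<close>, and its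
  q-th power does not reach the coefficient \<open>n\<close>.\<close>

lemma fps_power_q_nth:
  fixes f :: "'c fps"
  shows "fps_nth (f ^ q) n = (if q dvd n then fps_nth f (n div q) ^ q else 0)"
proof -
  let ?S = "\<Sum>i\<le>n. fps_const (fps_nth f i) * fps_X ^ i"
  have "fps_nth (f - ?S) i = 0" if "i < Suc n" for i
    using that by (simp add: fps_sum_nth if_distrib sum.delta cong: if_cong)
  then have "f - ?S = fps_X ^ Suc n * fps_shift (Suc n) (f - ?S)"
    by (intro fps_ext) (simp add: fps_X_power_mult_nth del: power_Suc fps_sub_nth)
  then obtain g where "f - ?S = fps_X ^ Suc n * g"
    by blast
  then have "f = ?S + fps_X ^ Suc n * g"
    by (metis add.commute diff_add_cancel)
  then have "f ^ q = ?S ^ q + (fps_X ^ Suc n * g) ^ q"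
    using power_q_add[OF frobenius_fps, of ?S "fps_X ^ Suc n * g" 1] by simp
  also have "(fps_X ^ Suc n * g) ^ q = fps_X ^ (Suc n * q) * g ^ q"
    by (simp only: power_mult_distrib power_mult)
  finally have "fps_nth (f ^ q) n = fps_nth (?S ^ q) n + fps_nth (fps_X ^ (Suc n * q) * g ^ q) n"
    by simp
  moreover have "Suc n * 1 \<le> Suc n * q"
    using q_gt_1 by (intro mult_le_mono2) simp
  ultimately have "fps_nth (f ^ q) n = fps_nth (?S ^ q) n"
    by (simp add: fps_X_power_mult_nth)
  also have "?S ^ q = (\<Sum>i\<le>n. fps_const (fps_nth f i ^ q) * fps_X ^ (i * q))"
    using power_q_sum[OF frobenius_fps, of "\<lambda>i. fps_const (fps_nth f i) * fps_X ^ i" "{..n}" 1]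
    by (simp add: power_mult_distrib fps_const_power power_mult)
  also have "fps_nth \<dots> n = (\<Sum>i\<le>n. if n = i * q then fps_nth f i ^ q else 0)"
    by (simp add: fps_sum_nth if_distrib cong: if_cong)
  also have "\<dots> = (if q dvd n then fps_nth f (n div q) ^ q else 0)"
  proof (cases "q dvd n")
    case True
    then obtain m where m: "n = m * q"
      by (auto simp: dvd_def mult.commute)
    have "(\<Sum>i\<le>n. if n = i * q then fps_nth f i ^ q else 0) =
        (\<Sum>i\<le>n. if i = m then fps_nth f i ^ q else 0)"
      using q_pos by (intro sum.cong) (auto simp: m)
    then show ?thesis
      using q_pos by (simp add: m)
  qed (auto intro!: sum.neutral)
  finally show ?thesis .
qed

text \<open>The recursion is forced by comparing coefficients of \<open>z ^ q ^ i\<close> in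
  \<open>e(T z) = T e(z) + e(z) ^ q\<close>; these are the reciprocals of the usual
  \<open>D_i\<close> of the Carlitz exponential.\<close>

primrec exp_coeff :: "nat \<Rightarrow> 'c" where
  "exp_coeff 0 = 1"
| "exp_coeff (Suc i) = exp_coeff i ^ q / (T ^ q ^ Suc i - T)"

definition carlitz_exp :: "'c fps" where
  "carlitz_exp = Abs_fps (\<lambda>n. if n \<in> range ((^) q) then exp_coeff (THE i. n = q ^ i) else 0)"

lemma q_power_inj: "q ^ i = q ^ j \<longleftrightarrow> i = j"
  using q_gt_1 by simp

lemma carlitz_exp_nth: "fps_nth carlitz_exp (q ^ i) = exp_coeff i"
  by (auto simp: carlitz_exp_def q_power_inj)

lemma carlitz_exp_nth_eq_0: "(\<And>i. n \<noteq> q ^ i) \<Longrightarrow> fps_nth carlitz_exp n = 0"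
  by (auto simp: carlitz_exp_def)

lemma carlitz_exp_0: "fps_nth carlitz_exp 0 = 0"
  by (rule carlitz_exp_nth_eq_0) (use q_pos in simp)

lemma carlitz_exp_1: "fps_nth carlitz_exp (Suc 0) = 1"
  using carlitz_exp_nth[of 0] by simp

abbreviation dilate :: "'c \<Rightarrow> 'c fps \<Rightarrow> 'c fps" where
  "dilate x f \<equiv> f oo (fps_const x * fps_X)"

lemma dilate_carlitz_exp_T:
  "dilate (T * x) carlitz_exp = fps_const T * dilate x carlitz_exp + dilate x carlitz_exp ^ q"
proof (rule fps_ext)
  fix n
  show "fps_nth (dilate (T * x) carlitz_exp) n =
      fps_nth (fps_const T * dilate x carlitz_exp + dilate x carlitz_exp ^ q) n"
  proof (cases "n \<in> range ((^) q)")
    case True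
    then obtain i where n: "n = q ^ i"
      by auto
    show ?thesis
    proof (cases i)
      case 0
      then show ?thesis
        using q_gt_1 by (simp add: n fps_power_q_nth fps_nth_compose_linear)
    next
      case (Suc k)
      have "1 < q ^ Suc k"
        using q_gt_1 by (intro one_less_power) auto
      then have "T ^ q ^ Suc k - T \<noteq> 0"
        using T_power_neq[of "q ^ Suc k"] by (simp del: power_Suc)
      then have "exp_coeff (Suc k) * T ^ q ^ Suc k = T * exp_coeff (Suc k) + exp_coeff k ^ q"
        by (simp add: field_simps)
      then have "(exp_coeff (Suc k) * T ^ q ^ Suc k) * x ^ q ^ Suc k =
          (T * exp_coeff (Suc k) + exp_coeff k ^ q) * x ^ q ^ Suc k"
        by (rule arg_cong)
      moreover have "(x ^ q ^ k) ^ q = x ^ q ^ Suc k"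
        by (simp add: power_mult[symmetric] mult.commute)
      moreover have "q dvd q ^ Suc k" "q ^ Suc k div q = q ^ k"
        using q_pos by auto
      ultimately show ?thesis
        unfolding n Suc fps_add_nth fps_mult_left_const_nth fps_nth_compose_linear fps_power_q_nth carlitz_exp_nth
        by (simp add: power_mult_distrib carlitz_exp_nth algebra_simps del: power_Suc exp_coeff.simps)
    qed
  next
    case False
    then have *: "fps_nth carlitz_exp n = 0"
      by (intro carlitz_exp_nth_eq_0) auto
    have "fps_nth carlitz_exp (n div q) = 0" if "q dvd n"
    proof (rule carlitz_exp_nth_eq_0)
      fix i show "n div q \<noteq> q ^ i"
        using False that by (metis dvd_mult_div_cancel power_Suc rangeI)
    qed
    with * show ?thesis
      using q_pos by (simp add: fps_nth_compose_linear fps_power_q_nth)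
  qed
qed

lemma dilate_carlitz_exp_T_power:
  "dilate (T ^ k) carlitz_exp = ((\<lambda>y. fps_const T * y + y ^ q) ^^ k) carlitz_exp"
  by (induction k) (auto simp: dilate_carlitz_exp_T)

text \<open>Only exponents \<open>q ^ i\<close> occur in \<open>carlitz_exp\<close>, and raising to
  such a power is additive and fixes constants. So dilation by \<open>\<rho> a\<close> splits into
  dilations by powers of \<open>T\<close>, to which the relation for \<open>T\<close> applies
  repeatedly.\<close>

lemma carlitz_exp_functional:
  "dilate (\<rho> a) carlitz_exp =
     (\<Sum>i\<le>Polynomial.degree a. fps_const (carlitz_coeff a i) * carlitz_exp ^ q ^ i)"
proof -
  have "dilate (\<rho> a) carlitz_exp = (\<Sum>k\<le>Polynomial.degree a.
      fps_const (\<rho> [:Polynomial.coeff a k:]) * dilate (T ^ k) carlitz_exp)"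
  proof (rule fps_ext)
    fix n
    show "fps_nth (dilate (\<rho> a) carlitz_exp) n = fps_nth (\<Sum>k\<le>Polynomial.degree a.
      fps_const (\<rho> [:Polynomial.coeff a k:]) * dilate (T ^ k) carlitz_exp) n"
    proof (cases "n \<in> range ((^) q)")
      case True
      then obtain i where n: "n = q ^ i"
        by auto
      have "\<rho> a ^ n = (\<Sum>k\<le>Polynomial.degree a. \<rho> [:Polynomial.coeff a k:] * (T ^ k) ^ n)"
        by (subst rho_eq_sum)
           (simp add: n power_q_sum[OF frobenius_base] power_mult_distrib rho_const_power)
      then show ?thesis
        by (simp add: fps_sum_nth fps_nth_compose_linear sum_distrib_right mult.assoc)
    next
      case False
      then have "fps_nth carlitz_exp n = 0"
        by (intro carlitz_exp_nth_eq_0) auto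
      then show ?thesis
        by (simp add: fps_sum_nth fps_nth_compose_linear)
    qed
  qed
  also have "\<dots> = (\<Sum>i\<le>Polynomial.degree a. fps_const (carlitz_coeff a i) * carlitz_exp ^ q ^ i)"
    unfolding dilate_carlitz_exp_T_power
    by (rule carlitz_sum) (use frobenius_fps in auto)
  finally show ?thesis .
qed

end

section \<open>Formal translations\<close>

lemma finite_degree_le: "finite {p :: 'a::{finite,zero} poly. Polynomial.degree p \<le> n}"
proof (rule finite_subset)
  show "{p :: 'a poly. Polynomial.degree p \<le> n} \<subseteq> Poly ` {xs. set xs \<subseteq> UNIV \<and> length xs \<le> Suc n}"
  proof
    fix p :: "'a poly" assume "p \<in> {p. Polynomial.degree p \<le> n}"
    then show "p \<in> Poly ` {xs. set xs \<subseteq> UNIV \<and> length xs \<le> Suc n}"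
      by (cases "p = 0") (auto intro!: image_eqI[where x = "coeffs p"] simp: length_coeffs_degree)
  qed
qed (use finite_lists_length_le[of "UNIV :: 'a set" "Suc n"] in simp)

text \<open>Vandermonde: test against the polynomial vanishing at all the other nodes.\<close>

lemma power_sums_eq_0_imp:
  fixes y :: "'b \<Rightarrow> 'c::field"
  assumes "finite S" "inj_on y S" and sums: "\<And>l. (\<Sum>a\<in>S. g a * y a ^ l) = 0" and "a \<in> S"
  shows "g a = 0"
proof -
  define p where "p = (\<Prod>b\<in>S - {a}. [:- y b, 1:])"
  have "(\<Sum>b\<in>S. g b * poly p (y b)) =
      (\<Sum>l\<le>Polynomial.degree p. Polynomial.coeff p l * (\<Sum>b\<in>S. g b * y b ^ l))"
    by (simp add: poly_altdef sum_distrib_left mult.left_commute)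
       (subst sum.swap, simp)
  then have "0 = (\<Sum>b\<in>S. g b * poly p (y b))"
    by (simp add: sums)
  also have "\<dots> = (\<Sum>b\<in>{a}. g b * poly p (y b))"
    using assms by (intro sum.mono_neutral_right) (auto simp: p_def poly_prod)
  finally have "g a * poly p (y a) = 0"
    by simp
  moreover have "poly p (y a) \<noteq> 0"
    using assms by (auto simp: p_def poly_prod inj_on_def)
  ultimately show ?thesis
    by simp
qed

text \<open>\<open>mobius E\<close> is \<open>X / (1 + E X)\<close>, the effect on \<open>t = 1 / e(z)\<close> of replacing \<open>e(z)\<close> by \<open>e(z) + E\<close>.\<close>

definition mobius :: "'b::comm_ring_1 \<Rightarrow> 'b fps" where
  "mobius E = Abs_fps (\<lambda>k. if k = 0 then 0 else (- E) ^ (k - 1))"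

lemma mobius_nth_0: "fps_nth (mobius E) 0 = 0"
  by (simp add: mobius_def)

lemma mobius_mult: "mobius E * (1 + fps_const E * fps_X) = fps_X"
proof (rule fps_ext)
  fix n
  have "mobius E * (1 + fps_const E * fps_X) = mobius E + fps_const E * (mobius E * fps_X)"
    by (simp only: distrib_left mult_1_right mult.left_commute)
  then have "fps_nth (mobius E * (1 + fps_const E * fps_X)) n =
      fps_nth (mobius E) n + E * (if n = 0 then 0 else fps_nth (mobius E) (n - 1))"
    by simp
  also have "\<dots> = fps_nth fps_X n"
  proof (cases n)
    case (Suc m)
    then show ?thesis
      by (cases m) (auto simp: mobius_def)
  qed (simp add: mobius_def)
  finally show "fps_nth (mobius E * (1 + fps_const E * fps_X)) n = fps_nth fps_X n" .
qed

section \<open>Homogeneity of the series X / (1 + E X) and power series in two variables\<close>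

lemma fps_const_sum: "fps_const (sum f A) = (\<Sum>x\<in>A. fps_const (f x))"
  by (induction A rule: infinite_finite_induct) (auto simp: fps_const_add[symmetric] simp del: fps_const_add)

lemma one_plus_X_power_nth:
  "m < k \<Longrightarrow> fps_nth ((1 + fps_X :: 'c::comm_ring_1 fps) ^ m) k = 0"
  by (induction m arbitrary: k) (auto simp: algebra_simps)

lemma fps_minus_power: "(- f) ^ n = fps_const ((- 1) ^ n) * (f :: 'c::comm_ring_1 fps) ^ n"
  by (induction n) (auto simp: fps_const_neg[symmetric] algebra_simps simp del: fps_const_neg)

lemma mobius_nth:
  fixes E :: "'c::comm_ring_1 fps"
  shows "fps_nth (mobius E) k = fps_const (fps_nth (mobius 1) k) * E ^ (k - 1)"
  by (simp add: mobius_def fps_minus_power)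

text \<open>\<open>X / (1 + E X)\<close> is homogeneous, so the coefficient of \<open>X ^ r\<close>
  in its i-th power is a scalar times \<open>E ^ (r - i)\<close>. For \<open>r < i\<close> the
  scalar is zero, which makes the truncated subtraction harmless.\<close>

lemma mobius_power_nth:
  fixes E :: "'c::comm_ring_1 fps"
  shows "fps_nth (mobius E ^ i) r = fps_const (fps_nth (mobius 1 ^ i) r) * E ^ (r - i)"
proof (induction i arbitrary: r)
  case (Suc i)
  have "fps_nth (mobius E ^ Suc i) r =
      (\<Sum>k=0..r. fps_nth (mobius E) k * fps_nth (mobius E ^ i) (r - k))"
    by (simp add: fps_mult_nth)
  also have "\<dots> = (\<Sum>k=0..r. fps_const (fps_nth (mobius 1) k * fps_nth (mobius 1 ^ i) (r - k)) * E ^ (r - Suc i))"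
  proof (rule sum.cong[OF refl])
    fix k assume "k \<in> {0..r}"
    then have k: "k \<le> r"
      by simp
    show "fps_nth (mobius E) k * fps_nth (mobius E ^ i) (r - k) =
        fps_const (fps_nth (mobius 1) k * fps_nth (mobius 1 ^ i) (r - k)) * E ^ (r - Suc i)"
    \<comment> \<open>In these edge cases a factor vanishes on both sides; otherwise the exponents
      add up without truncation.\<close>
    proof (cases "k = 0 \<or> r - k < i")
      case True
      then have "k = 0 \<or> fps_nth (mobius (1::'c) ^ i) (r - k) = 0"
        using startsby_zero_power_prefix[OF mobius_nth_0, of i] by auto
      then show ?thesis
        unfolding Suc by (auto simp: mobius_nth_0)
    next
      case False
      then have "r - Suc i = (k - 1) + (r - k - i)"
        using k by linarith
      then show ?thesis
        by (simp only: Suc mobius_nth[of E k] power_add fps_const_mult[symmetric] ac_simps)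
    qed
  qed
  also have "\<dots> = fps_const (fps_nth (mobius 1 ^ Suc i) r) * E ^ (r - Suc i)"
    by (simp add: fps_mult_nth sum_distrib_right[symmetric] fps_const_sum[symmetric])
  finally show ?case .
next
  case 0
  then show ?case by simp
qed

text \<open>The outer variable plays the role of \<open>t\<close>, the inner one that of the
  translation parameter \<open>h\<close>; a lifted series is constant in \<open>h\<close>.\<close>

definition lift :: "'c::comm_ring_1 fps \<Rightarrow> 'c fps fps" where
  "lift f = Abs_fps (\<lambda>k. fps_const (fps_nth f k))"

lemma lift_nth [simp]: "fps_nth (lift f) k = fps_const (fps_nth f k)"
  by (simp add: lift_def)

lemma lift_const: "lift (fps_const x) = fps_const (fps_const x)"
  by (rule fps_ext) auto

lemma lift_X: "lift fps_X = fps_X"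
  by (rule fps_ext) auto

lemma lift_0: "lift 0 = 0"
  by (rule fps_ext) auto

lemma lift_1: "lift 1 = 1"
  by (rule fps_ext) auto

lemma lift_add: "lift (f + g) = lift f + lift g"
  by (rule fps_ext) auto

lemma lift_mult: "lift (f * g) = lift f * lift g"
  by (rule fps_ext) (simp add: fps_mult_nth fps_const_sum)

lemma lift_sum: "lift (sum f A) = (\<Sum>x\<in>A. lift (f x))"
  by (induction A rule: infinite_finite_induct) (auto simp: lift_0 lift_add)

lemma lift_power: "lift (f ^ n) = lift f ^ n"
  by (induction n) (auto simp: lift_1 lift_mult)

lemma lift_compose: "lift (f oo g) = lift f oo lift g"
  by (rule fps_ext) (simp add: fps_compose_nth fps_const_sum flip: lift_power)

section \<open>Translation of the series for t_a and linear independence\<close>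

context poly_embedding
begin

text \<open>As \<open>e(a z) = \<Sum>\<^sub>i carlitz_coeff a i \<cdot> e(z) ^ q ^ i\<close>, the series \<open>t\<^sub>a\<close> is \<open>X ^ q ^ deg a / t_denom a\<close>.\<close>

definition t_denom :: "'f poly \<Rightarrow> 'c fps" where
  "t_denom a = (\<Sum>i\<le>Polynomial.degree a.
     fps_const (carlitz_coeff a i) * fps_X ^ (q ^ Polynomial.degree a - q ^ i))"

lemma t_denom_0:
  assumes "a \<in> A_plus"
  shows "fps_nth (t_denom a) 0 = 1"
proof -
  let ?d = "Polynomial.degree a"
  have "fps_nth (t_denom a) 0 = (\<Sum>i\<in>{?d}. carlitz_coeff a i * fps_nth (fps_X ^ (q ^ ?d - q ^ i)) 0)"
    unfolding t_denom_def fps_sum_nth fps_mult_left_const_nth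
    by (rule sum.mono_neutral_right) (use q_gt_1 in auto)
  then show ?thesis
    using carlitz_coeff_degree[OF assms] by simp
qed

lemma t_power:
  assumes "a \<in> A_plus" and "t * t_denom a = fps_X ^ q ^ Polynomial.degree a"
  shows "t ^ r = fps_X ^ (q ^ Polynomial.degree a * r) * inverse (t_denom a) ^ r"
proof -
  have "inverse (t_denom a) * t_denom a = 1"
    using t_denom_0[OF assms(1)] by (intro inverse_mult_eq_1) simp
  then have "t = fps_X ^ q ^ Polynomial.degree a * inverse (t_denom a)"
    using assms(2) by (metis mult.assoc mult.commute mult.right_neutral)
  then show ?thesis
    by (simp add: power_mult_distrib power_mult)
qed

lemma t_power_nth:
  assumes "a \<in> A_plus" and "t * t_denom a = fps_X ^ q ^ Polynomial.degree a"
  shows "k < q ^ Polynomial.degree a * r \<Longrightarrow> fps_nth (t ^ r) k = 0"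
    and "fps_nth (t ^ r) (q ^ Polynomial.degree a * r) = 1"
  using t_denom_0[OF assms(1)]
  by (simp_all add: t_power[OF assms] fps_X_power_mult_nth fps_nth_power_0)

lemma t_nth_0:
  assumes "a \<in> A_plus" and "t * t_denom a = fps_X ^ q ^ Polynomial.degree a"
  shows "fps_nth t 0 = 0"
  using t_power_nth(1)[OF assms, of 0 1] q_pos by simp

text \<open>\<open>t\<^sub>a(z + h) = t\<^sub>a / (1 + e(a h) t\<^sub>a)\<close>, with \<open>h\<close> the variable of the inner power series.\<close>

lemma t_shift:
  assumes "a \<in> A_plus" and t: "t * t_denom a = fps_X ^ q ^ Polynomial.degree a"
  shows "lift t oo mobius carlitz_exp = mobius (dilate (\<rho> a) carlitz_exp) oo lift t"
proof -
  let ?d = "Polynomial.degree a"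
  define Q where "Q = q ^ ?d"
  define w where "w = mobius carlitz_exp"
  define u where "u = 1 + fps_const carlitz_exp * fps_X"
  define E where "E = dilate (\<rho> a) carlitz_exp"
  define D where "D = lift (t_denom a)"
  define s where "s = lift t oo w"
  have w0: "fps_nth w 0 = 0"
    by (simp add: w_def mobius_nth_0)
  have wu: "w * u = fps_X"
    unfolding w_def u_def by (rule mobius_mult)
  have tD: "lift t * D = fps_X ^ Q"
    using arg_cong[OF t, of lift] by (simp add: D_def Q_def lift_mult lift_power lift_X)
  have D_eq: "D = (\<Sum>i\<le>?d. fps_const (fps_const (carlitz_coeff a i)) * fps_X ^ (Q - q ^ i))"
    by (simp add: D_def Q_def t_denom_def lift_sum lift_mult lift_const lift_power lift_X)
  have sD: "s * (D oo w) = w ^ Q"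
    using arg_cong[OF tD, of "\<lambda>f. f oo w"] w0
    by (simp add: s_def fps_compose_mult_distrib fps_compose_power[symmetric])
  \<comment> \<open>Since \<open>w * u = fps_X\<close>, the factor \<open>u ^ Q\<close> clears the
    denominators of \<open>D oo w\<close>. Splitting \<open>Q = (Q - q ^ i) + q ^ i\<close> leaves
    \<open>u ^ q ^ i\<close>, which Frobenius expands into two terms.\<close>
  have "(D oo w) * u ^ Q = (\<Sum>i\<le>?d. fps_const (fps_const (carlitz_coeff a i)) *
      (w ^ (Q - q ^ i) * u ^ Q))"
    using w0 by (simp add: D_eq fps_compose_sum_distrib fps_compose_mult_distrib
        fps_compose_power[symmetric] sum_distrib_right mult.assoc)
  also have "\<dots> = (\<Sum>i\<le>?d. fps_const (fps_const (carlitz_coeff a i)) *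
      (fps_X ^ (Q - q ^ i) + fps_X ^ Q * fps_const (carlitz_exp ^ q ^ i)))"
  proof (rule sum.cong[OF refl])
    fix i assume "i \<in> {..?d}"
    then have Qi: "Q = (Q - q ^ i) + q ^ i"
      using q_gt_1 by (simp add: Q_def power_increasing)
    have "w ^ (Q - q ^ i) * u ^ Q = (w * u) ^ (Q - q ^ i) * u ^ q ^ i"
      by (subst (2) Qi) (simp only: power_add power_mult_distrib mult.assoc)
    also have "u ^ q ^ i = 1 + fps_const (carlitz_exp ^ q ^ i) * fps_X ^ q ^ i"
      by (simp add: u_def power_q_add[OF frobenius_fps_fps] power_mult_distrib fps_const_power)
    also have "(w * u) ^ (Q - q ^ i) * \<dots> =
        fps_X ^ (Q - q ^ i) + fps_X ^ ((Q - q ^ i) + q ^ i) * fps_const (carlitz_exp ^ q ^ i)"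
      unfolding wu by (simp add: algebra_simps power_add)
    finally show "fps_const (fps_const (carlitz_coeff a i)) * (w ^ (Q - q ^ i) * u ^ Q) =
        fps_const (fps_const (carlitz_coeff a i)) *
          (fps_X ^ (Q - q ^ i) + fps_X ^ Q * fps_const (carlitz_exp ^ q ^ i))"
      by (simp only: Qi[symmetric])
  qed
  also have "\<dots> = D + fps_X ^ Q * fps_const E"
    unfolding E_def carlitz_exp_functional
    by (simp add: D_eq sum.distrib algebra_simps sum_distrib_left fps_const_sum
          fps_const_mult[symmetric] del: fps_const_mult)
  finally have Du: "(D oo w) * u ^ Q = D + fps_X ^ Q * fps_const E" .
  have "s * (D + fps_X ^ Q * fps_const E) = fps_X ^ Q"
    unfolding Du[symmetric] mult.assoc[symmetric] sD power_mult_distrib[symmetric] wu ..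
  then have "D * (s * (1 + fps_const E * lift t)) = D * lift t"
    unfolding tD[symmetric] by (simp add: algebra_simps)
  moreover have "D \<noteq> 0"
    using tD by auto
  ultimately have s: "s * (1 + fps_const E * lift t) = lift t"
    by simp
  have t0: "fps_nth (lift t) 0 = 0"
    using t_nth_0[OF assms] by simp
  \<comment> \<open>Both \<open>s\<close> and \<open>mobius E oo lift t\<close> solve the same
    linear equation, whose factor has constant term 1 and so can be cancelled.\<close>
  have "(mobius E oo lift t) * (1 + fps_const E * lift t) = lift t"
    using arg_cong[OF mobius_mult[of E], of "\<lambda>f. f oo lift t"] t0
    by (simp add: fps_compose_mult_distrib fps_compose_add_distrib)
  moreover have "1 + fps_const E * lift t \<noteq> 0"
  proof
    assume "1 + fps_const E * lift t = 0"
    then have "fps_nth (1 + fps_const E * lift t) 0 = 0"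
      by simp
    then show False
      using t0 by simp
  qed
  ultimately have "s = mobius E oo lift t"
    using s by (metis mult_right_cancel)
  then show ?thesis
    by (simp add: s_def w_def E_def)
qed

text \<open>\<open>G(X / (1 + X e(h))) = \<Sum> shift_coeff G j r \<cdot> h ^ j \<cdot> X ^ r\<close>.\<close>

definition shift_coeff :: "'c fps \<Rightarrow> nat \<Rightarrow> nat \<Rightarrow> 'c" where
  "shift_coeff G j r = fps_nth (fps_nth (lift G oo mobius carlitz_exp) r) j"

text \<open>Replacing \<open>h\<close> by \<open>x h\<close> multiplies the coefficient of
  \<open>h ^ j\<close> by \<open>x ^ j\<close> and leaves the outer variable alone. This is where
  the factor \<open>\<rho> a ^ j\<close> comes from.\<close>

lemma shift_coeff_dilate:
  "fps_nth (fps_nth (lift G oo mobius (dilate x carlitz_exp)) r) j = x ^ j * shift_coeff G j r"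
proof -
  have "fps_nth (dilate x carlitz_exp ^ m) j = x ^ j * fps_nth (carlitz_exp ^ m) j" for m
    by (simp add: fps_compose_power)
  then show ?thesis
    by (simp add: shift_coeff_def fps_compose_nth[of "lift G"] mobius_power_nth fps_sum_nth
        sum_distrib_left mult.assoc mult.left_commute)
qed

lemma shift_coeff_eq_sum:
  "shift_coeff G j r =
     (\<Sum>i=0..r. fps_nth G i * fps_nth (mobius 1 ^ i) r * fps_nth (carlitz_exp ^ (r - i)) j)"
  by (simp add: shift_coeff_def fps_compose_nth[of "lift G"] mobius_power_nth fps_sum_nth mult.assoc)

text \<open>\<open>(1 + X)\<^sup>-\<^sup>N = (1 + X)\<^sup>Q\<^sup>-\<^sup>N / (1 + X\<^sup>Q)\<close> with \<open>Q = q ^ M\<close>, and the numerator has degree less than \<open>Q\<close>.\<close>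

lemma mobius_power_nth_neq_0:
  assumes "N \<le> q ^ M" "N > 0"
  shows "fps_nth (mobius 1 ^ N) (N + q ^ M * l) \<noteq> (0::'c)"
proof -
  define Q where "Q = q ^ M"
  have Q: "Q > 0"
    using q_pos by (simp add: Q_def)
  \<comment> \<open>\<open>V\<close> is the geometric series of
    \<open>1 / (1 + X ^ Q)\<close>.\<close>
  define V :: "'c fps" where "V = Abs_fps (\<lambda>n. if Q dvd n then (- 1) ^ (n div Q) else 0)"
  have V: "V * (1 + fps_X ^ Q) = 1"
  proof (rule fps_ext)
    fix n
    show "fps_nth (V * (1 + fps_X ^ Q)) n = fps_nth 1 n"
    proof (cases "n < Q")
      case True
      then show ?thesis
        by (cases "n = 0") (auto simp: V_def algebra_simps fps_X_power_mult_nth dest: dvd_imp_le)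
    next
      case False
      then have "n div Q = Suc ((n - Q) div Q)" "Q dvd n - Q \<longleftrightarrow> Q dvd n"
        using Q by (auto simp: le_div_geq dvd_minus_self)
      then show ?thesis
        using False Q by (auto simp: V_def algebra_simps fps_X_power_mult_nth)
    qed
  qed
  have "(mobius (1::'c) * (1 + fps_X)) ^ N = fps_X ^ N"
    using mobius_mult[of "1::'c"] by simp
  then have "mobius (1::'c) ^ N * (1 + fps_X) ^ N * (1 + fps_X) ^ (Q - N) =
      fps_X ^ N * (1 + fps_X) ^ (Q - N)"
    by (simp add: power_mult_distrib)
  moreover have "(1 + fps_X :: 'c fps) ^ N * (1 + fps_X) ^ (Q - N) = 1 + fps_X ^ Q"
    using assms power_q_add[OF frobenius_fps, of 1 fps_X M]
    by (simp add: Q_def power_add[symmetric])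
  ultimately have *: "mobius (1::'c) ^ N * (1 + fps_X ^ Q) = fps_X ^ N * (1 + fps_X) ^ (Q - N)"
    by (simp add: mult.assoc)
  have "mobius (1::'c) ^ N = mobius 1 ^ N * (V * (1 + fps_X ^ Q))"
    by (simp add: V)
  also have "\<dots> = V * (mobius 1 ^ N * (1 + fps_X ^ Q))"
    by (simp only: ac_simps)
  also have "\<dots> = fps_X ^ N * (V * (1 + fps_X) ^ (Q - N))"
    by (simp only: * ac_simps)
  finally have "fps_nth (mobius (1::'c) ^ N) (N + Q * l) = fps_nth (V * (1 + fps_X) ^ (Q - N)) (Q * l)"
    by (simp add: fps_X_power_mult_nth)
  also have "\<dots> = (\<Sum>k=0..Q*l. fps_nth V k * fps_nth ((1 + fps_X) ^ (Q - N)) (Q * l - k))"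
    by (simp add: fps_mult_nth)
  \<comment> \<open>A nonzero coefficient of \<open>V\<close> needs \<open>Q dvd k\<close>. Then
    \<open>Q * l - k\<close> is zero or at least \<open>Q\<close>, and in the latter case it exceeds
    the degree \<open>Q - N\<close> of the other factor.\<close>
  also have "\<dots> = (\<Sum>k\<in>{Q*l}. fps_nth V k * fps_nth ((1 + fps_X) ^ (Q - N)) (Q * l - k))"
  proof (rule sum.mono_neutral_right)
    show "\<forall>k\<in>{0..Q*l} - {Q*l}. fps_nth V k * fps_nth ((1 + fps_X) ^ (Q - N)) (Q * l - k) = 0"
    proof
      fix k assume k: "k \<in> {0..Q*l} - {Q*l}"
      show "fps_nth V k * fps_nth ((1 + fps_X) ^ (Q - N)) (Q * l - k) = 0"
      proof (cases "Q dvd k")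
        case True
        then have "Q dvd Q * l - k"
          by simp
        then have "Q \<le> Q * l - k"
          using k by (intro dvd_imp_le) auto
        then have "Q - N < Q * l - k"
          using assms Q by linarith
        then show ?thesis
          by (simp add: one_plus_X_power_nth)
      qed (simp add: V_def)
    qed
  qed auto
  also have "\<dots> = (- 1) ^ l"
    using Q by (simp add: V_def fps_nth_power_0)
  finally show ?thesis
    by (simp add: Q_def)
qed

text \<open>At the index \<open>N + j\<close>, with \<open>j = q ^ M * l\<close>, only the top term
  of \<open>G\<close> survives: for \<open>i < N\<close> the series
  \<open>carlitz_exp ^ (N + j - i)\<close> has order greater than \<open>j\<close>.\<close>

lemma shift_coeff_neq_0:
  assumes "fps_nth G N \<noteq> 0" "\<And>i. i > N \<Longrightarrow> fps_nth G i = 0" and "N \<le> q ^ M" "N > 0"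
  shows "shift_coeff G (q ^ M * l) (N + q ^ M * l) \<noteq> 0"
proof -
  let ?j = "q ^ M * l"
  let ?f = "\<lambda>i. fps_nth G i * fps_nth (mobius 1 ^ i) (N + ?j) * fps_nth (carlitz_exp ^ (N + ?j - i)) ?j"
  have "shift_coeff G ?j (N + ?j) = (\<Sum>i\<in>{N}. ?f i)"
    unfolding shift_coeff_eq_sum
  proof (rule sum.mono_neutral_right)
    show "\<forall>i\<in>{0..N + ?j} - {N}. ?f i = 0"
    proof
      fix i assume i: "i \<in> {0..N + ?j} - {N}"
      then consider "i > N" | "?j < N + ?j - i"
        by force
      then show "?f i = 0"
        using assms(2) startsby_zero_power_prefix[OF carlitz_exp_0] by cases auto
    qed
  qed auto
  also have "\<dots> = fps_nth G N * fps_nth (mobius 1 ^ N) (N + ?j)"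
    using startsby_zero_power_nth_same[OF carlitz_exp_0, of ?j] by (simp add: carlitz_exp_1)
  finally show ?thesis
    using assms(1) mobius_power_nth_neq_0[OF assms(3,4)] by simp
qed

theorem A_expansion_independent:
  fixes t :: "'f poly \<Rightarrow> 'c fps" and g :: "'f poly \<Rightarrow> 'c"
  assumes t: "\<And>a. a \<in> A_plus \<Longrightarrow> t a * t_denom a = fps_X ^ q ^ Polynomial.degree a"
    and G: "fps_nth G N \<noteq> 0" "\<And>i. i > N \<Longrightarrow> fps_nth G i = 0" "fps_nth G 0 = 0"
    and rel: "\<And>k. (\<Sum>a | a \<in> A_plus \<and> Polynomial.degree a \<le> k. g a * fps_nth (G oo t a) k) = 0"
  shows "\<forall>a\<in>A_plus. g a = 0"
proof -
  define B where "B k = {a :: 'f poly. a \<in> A_plus \<and> Polynomial.degree a \<le> k}" for k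
  have fin: "finite (B k)" for k
    by (rule finite_subset[OF _ finite_degree_le[of k]]) (auto simp: B_def)
  have N: "N > 0"
    using G by (intro gr0I) auto
  have deg_less: "n < q ^ n" for n
  proof -
    have "2 ^ n \<le> q ^ n"
      using q_gt_1 by (intro power_mono) auto
    then show ?thesis
      using less_exp[of n] by linarith
  qed
  then obtain M where M: "N \<le> q ^ M"
    using less_imp_le by blast
  have Gt_nth: "fps_nth (G oo t a) k = 0" if "a \<in> A_plus" "k < q ^ Polynomial.degree a" for a k
  proof -
    have "fps_nth G i * fps_nth (t a ^ i) k = 0" for i
    proof (cases "i = 0")
      case False
      then have "q ^ Polynomial.degree a * 1 \<le> q ^ Polynomial.degree a * i"
        by (intro mult_le_mono2) auto
      with that have "k < q ^ Polynomial.degree a * i"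
        by linarith
      then show ?thesis
        using t_power_nth(1)[OF that(1) t[OF that(1)]] by simp
    qed (simp add: G)
    then show ?thesis
      by (simp only: fps_compose_nth sum.neutral_const)
  qed
  \<comment> \<open>This is the coefficient of \<open>h ^ j X ^ k\<close> in the translated
    relation. A finite part \<open>F\<close> suffices: its coefficients up to \<open>k\<close>
    vanish, and \<open>mobius carlitz_exp\<close> has no constant term.\<close>
  have main: "(\<Sum>a\<in>B k. g a * (\<Sum>r=0..k. \<rho> a ^ j * shift_coeff G j r * fps_nth (t a ^ r) k)) = 0"
    for j k
  proof -
    define F where "F = (\<Sum>a\<in>B k. fps_const (g a) * (G oo t a))"
    have F: "fps_nth F i = 0" if "i \<le> k" for i
    proof -
      have "fps_nth F i = (\<Sum>a\<in>B k. g a * fps_nth (G oo t a) i)"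
        by (simp add: F_def fps_sum_nth)
      \<comment> \<open>The order \<open>q ^ deg a\<close> of \<open>t a\<close> exceeds
        \<open>deg a\<close>, so polynomials of degree above \<open>i\<close> do not affect the
        coefficient \<open>i\<close>.\<close>
      also have "\<dots> = (\<Sum>a\<in>B i. g a * fps_nth (G oo t a) i)"
      proof (rule sum.mono_neutral_right)
        show "\<forall>a\<in>B k - B i. g a * fps_nth (G oo t a) i = 0"
        proof
          fix a assume "a \<in> B k - B i"
          then have "a \<in> A_plus" "i < q ^ Polynomial.degree a"
            using deg_less[of "Polynomial.degree a"] by (auto simp: B_def)
          then show "g a * fps_nth (G oo t a) i = 0"
            by (simp add: Gt_nth)
        qed
      qed (use fin that in \<open>auto simp: B_def\<close>)
      finally show ?thesis
        using rel[of i] by (simp add: B_def)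
    qed
    have "fps_nth (fps_nth (lift F oo mobius carlitz_exp) k) j = 0"
      by (simp add: fps_compose_nth F)
    moreover have "lift F oo mobius carlitz_exp =
      (\<Sum>a\<in>B k. fps_const (fps_const (g a)) *
        ((lift G oo mobius (dilate (\<rho> a) carlitz_exp)) oo lift (t a)))"
      unfolding F_def lift_sum fps_compose_sum_distrib
    proof (rule sum.cong[OF refl])
      fix a assume "a \<in> B k"
      then have a: "a \<in> A_plus"
        by (simp add: B_def)
      have t0: "fps_nth (t a) 0 = 0"
        by (rule t_nth_0[OF a t[OF a]])
      have "(lift G oo lift (t a)) oo mobius carlitz_exp = lift G oo (lift (t a) oo mobius carlitz_exp)"
        by (rule fps_compose_assoc[symmetric]) (simp_all add: mobius_nth_0 t0)
      also have "\<dots> = (lift G oo mobius (dilate (\<rho> a) carlitz_exp)) oo lift (t a)"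
        unfolding t_shift[OF a t[OF a]] by (rule fps_compose_assoc) (simp_all add: mobius_nth_0 t0)
      finally show "lift (fps_const (g a) * (G oo t a)) oo mobius carlitz_exp =
          fps_const (fps_const (g a)) * ((lift G oo mobius (dilate (\<rho> a) carlitz_exp)) oo lift (t a))"
        by (simp add: lift_mult lift_const lift_compose fps_compose_mult_distrib mobius_nth_0)
    qed
    ultimately have "0 = (\<Sum>a\<in>B k. g a * fps_nth (\<Sum>r=0..k.
        fps_nth (lift G oo mobius (dilate (\<rho> a) carlitz_exp)) r * fps_const (fps_nth (t a ^ r) k)) j)"
      by (simp add: fps_sum_nth fps_compose_nth[of "_ oo _"] lift_power[symmetric])
    then show ?thesis
      by (simp add: fps_sum_nth shift_coeff_dilate)
  qed
  have "g a = 0" if "a \<in> A_plus" for a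
    using that
  proof (induction "Polynomial.degree a" arbitrary: a rule: less_induct)
    case less
    define d where "d = Polynomial.degree a"
    define S where "S = {b :: 'f poly. b \<in> A_plus \<and> Polynomial.degree b = d}"
    have S: "S \<subseteq> B k" if "d \<le> k" for k
      using that by (auto simp: S_def B_def)
    have "(\<Sum>b\<in>S. g b * (\<rho> b ^ q ^ M) ^ l) = 0" for l
    proof -
      define j where "j = q ^ M * l"
      \<comment> \<open>\<open>m\<close> is the order in \<open>X\<close> of the coefficient of
        \<open>h ^ j\<close>. It exists because \<open>j\<close> is a multiple of
        \<open>q ^ M\<close>, and it is positive because \<open>G\<close> has no constant
        term.\<close>
      define m where "m = (LEAST r. shift_coeff G j r \<noteq> 0)"
      have m: "shift_coeff G j m \<noteq> 0"
        unfolding m_def using shift_coeff_neq_0[OF G(1,2) M N, of l] by (intro LeastI) (simp add: j_def)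
      have less_m: "shift_coeff G j r = 0" if "r < m" for r
        using not_less_Least[of r "\<lambda>r. shift_coeff G j r \<noteq> 0"] that by (auto simp: m_def)
      have "shift_coeff G j 0 = 0"
        by (simp add: shift_coeff_eq_sum G)
      with m have "m > 0"
        by (intro gr0I) auto
      \<comment> \<open>The order of \<open>t b ^ m\<close> for \<open>b\<close> of degree
        \<open>d\<close>; its coefficient there is 1.\<close>
      define k where "k = q ^ d * m"
      have "d \<le> k"
      proof -
        have "q ^ d * 1 \<le> q ^ d * m"
          using \<open>m > 0\<close> by (intro mult_le_mono2) simp
        then show ?thesis
          using deg_less[of d] unfolding k_def by linarith
      qed
      have inner: "(\<Sum>r=0..k. \<rho> b ^ j * shift_coeff G j r * fps_nth (t b ^ r) k) =
          (if b \<in> S then \<rho> b ^ j * shift_coeff G j m else 0)"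
        if b: "b \<in> A_plus" "d \<le> Polynomial.degree b" for b
      proof -
        \<comment> \<open>For \<open>r < m\<close> the shift coefficient vanishes. Otherwise the
          order \<open>q ^ deg b * r\<close> of \<open>t b ^ r\<close> exceeds \<open>k\<close>,
          unless \<open>r = m\<close> and \<open>deg b = d\<close>.\<close>
        have zero: "\<rho> b ^ j * shift_coeff G j r * fps_nth (t b ^ r) k = 0" if "r \<noteq> m \<or> b \<notin> S" for r
        proof (cases "r < m")
          case False
          have "k < q ^ Polynomial.degree b * r"
          proof (cases "r = m")
            case True
            with that b have "d < Polynomial.degree b"
              by (auto simp: S_def)
            then have "q ^ d < q ^ Polynomial.degree b"
              using q_gt_1 by (simp add: power_strict_increasing)
            then show ?thesis
              using True \<open>m > 0\<close> by (simp add: k_def)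
          next
            case False
            with \<open>\<not> r < m\<close> have "m < r"
              by simp
            have "q ^ d \<le> q ^ Polynomial.degree b"
              using q_gt_1 b by (simp add: power_increasing)
            then have "q ^ d * r \<le> q ^ Polynomial.degree b * r"
              by simp
            moreover have "k < q ^ d * r"
              using \<open>m < r\<close> q_pos by (simp add: k_def)
            ultimately show ?thesis
              by linarith
          qed
          then show ?thesis
            using t_power_nth(1)[OF b(1) t[OF b(1)]] by simp
        qed (simp add: less_m)
        show ?thesis
        proof (cases "b \<in> S")
          case True
          have "m \<le> k"
            using q_pos by (simp add: k_def)
          have "(\<Sum>r=0..k. \<rho> b ^ j * shift_coeff G j r * fps_nth (t b ^ r) k) =
              (\<Sum>r\<in>{m}. \<rho> b ^ j * shift_coeff G j r * fps_nth (t b ^ r) k)"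
            using \<open>m \<le> k\<close> zero by (intro sum.mono_neutral_right) auto
          moreover have "fps_nth (t b ^ m) k = 1"
            using t_power_nth(2)[OF b(1) t[OF b(1)], of m] True by (simp add: S_def k_def)
          ultimately show ?thesis
            using True by simp
        next
          case False
          then show ?thesis
            by (simp only: zero sum.neutral_const if_False simp_thms)
        qed
      qed
      have "0 = (\<Sum>b\<in>B k. g b * (\<Sum>r=0..k. \<rho> b ^ j * shift_coeff G j r * fps_nth (t b ^ r) k))"
        by (rule main[symmetric])
      also have "\<dots> = (\<Sum>b\<in>B k. if b \<in> S then g b * (\<rho> b ^ j * shift_coeff G j m) else 0)"
      proof (rule sum.cong[OF refl])
        fix b assume "b \<in> B k"
        then have b: "b \<in> A_plus"
          by (simp add: B_def)
        show "g b * (\<Sum>r=0..k. \<rho> b ^ j * shift_coeff G j r * fps_nth (t b ^ r) k) =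
            (if b \<in> S then g b * (\<rho> b ^ j * shift_coeff G j m) else 0)"
        proof (cases "d \<le> Polynomial.degree b")
          case False
          then have "g b = 0"
            using less.hyps[of b] b by (simp add: d_def)
          then show ?thesis
            by simp
        qed (simp add: inner[OF b])
      qed
      also have "\<dots> = (\<Sum>b\<in>S. g b * (\<rho> b ^ j * shift_coeff G j m))"
        using S[OF \<open>d \<le> k\<close>] fin[of k] by (simp add: sum.If_cases Int_absorb1)
      also have "\<dots> = (\<Sum>b\<in>S. g b * \<rho> b ^ j) * shift_coeff G j m"
        by (simp add: sum_distrib_right mult.assoc)
      finally show ?thesis
        using m by (simp add: j_def power_mult)
    qed
    \<comment> \<open>Only exponents divisible by \<open>q ^ M\<close> are available, so the
      Vandermonde nodes are \<open>\<rho> b ^ q ^ M\<close>. They stay distinct because an iterate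
      of Frobenius is injective.\<close>
    moreover have "inj_on (\<lambda>b. \<rho> b ^ q ^ M) S"
    proof (rule inj_onI)
      fix x y assume "\<rho> x ^ q ^ M = \<rho> y ^ q ^ M"
      then have "(\<rho> x - \<rho> y) ^ q ^ M = 0"
        using power_q_add[OF frobenius_base, of "\<rho> x - \<rho> y" "\<rho> y" M] by simp
      then show "x = y"
        by (simp add: rho_eq_iff)
    qed
    moreover have "finite S"
      using finite_subset[OF S fin] by blast
    ultimately show ?case
      using power_sums_eq_0_imp[of S "\<lambda>b. \<rho> b ^ q ^ M" g a] less.prems by (auto simp: S_def d_def)
  qed
  then show ?thesis
    by blast
qed

end

section \<open>Expansions at infinity\<close>

text \<open>The coefficient \<open>k\<close> of a partial sum is stationary once the finite index
  set contains all \<open>a\<close> in \<open>A\<close> of degree at most \<open>k\<close>; there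
  are finitely many of these over a finite field.\<close>

lemma infsum_fps_nth:
  fixes F :: "'f::{finite,field} poly \<Rightarrow> 'c::field fps"
  assumes "\<And>a k. \<lbrakk>a \<in> A; k < Polynomial.degree a\<rbrakk> \<Longrightarrow> fps_nth (F a) k = 0"
  shows "fps_nth (infsum F A) k = (\<Sum>a | a \<in> A \<and> Polynomial.degree a \<le> k. fps_nth (F a) k)"
proof -
  define B where "B k = {a \<in> A. Polynomial.degree a \<le> k}" for k
  have fin: "finite (B k)" for k
    by (rule finite_subset[OF _ finite_degree_le[of k]]) (auto simp: B_def)
  have "(F has_sum Abs_fps (\<lambda>k. \<Sum>a\<in>B k. fps_nth (F a) k)) A"
    unfolding has_sum_def
  proof (rule tendsto_fpsI)
    fix k
    have "fps_nth (sum F Y) k = (\<Sum>a\<in>B k. fps_nth (F a) k)" if "finite Y" "B k \<subseteq> Y" "Y \<subseteq> A" for Y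
      unfolding fps_sum_nth
    proof (rule sum.mono_neutral_right)
      show "\<forall>a\<in>Y - B k. fps_nth (F a) k = 0"
      proof
        fix a assume "a \<in> Y - B k"
        then have "a \<in> A" "k < Polynomial.degree a"
          using that by (auto simp: B_def not_le)
        then show "fps_nth (F a) k = 0"
          by (rule assms)
      qed
    qed (use that in auto)
    then show "eventually (\<lambda>Y. fps_nth (sum F Y) k = fps_nth (Abs_fps (\<lambda>k. \<Sum>a\<in>B k. fps_nth (F a) k)) k)
        (finite_subsets_at_top A)"
      unfolding eventually_finite_subsets_at_top using fin[of k]
      by (intro exI[of _ "B k"]) (auto simp: B_def)
  qed
  then show ?thesis
    by (simp add: infsumI B_def)
qed

lemma poly_map_fps_const:
  fixes t :: "'c::field fps"
  assumes "fps_nth t 0 = 0"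
  shows "poly (map_poly fps_const G) t = fps_of_poly G oo t"
proof (induction G)
  case (pCons c G)
  then show ?case
    using assms
    by (simp add: map_poly_pCons fps_of_poly_pCons fps_compose_add_distrib fps_compose_mult_distrib
        mult.commute)
qed simp

section \<open>The nonarchimedean absolute value and the embedding of A\<close>

abbreviation nrm :: "'c::{field,complete_space} \<Rightarrow> real" where
  "nrm x \<equiv> dist x 0"

context C_infty
begin

lemma nrm_1: "nrm (1::'c) = 1"
  using abs_mult[of 1 1] by simp

lemma nrm_minus: "nrm (- x) = nrm (x::'c)"
  using dist_diff[of 0 x] by (simp add: dist_commute)

lemma nrm_diff_le: "nrm (x - y) \<le> max (nrm x) (nrm (y::'c))"
  using abs_add[of x "- y"] by (simp add: nrm_minus)

lemma nrm_power: "nrm (x ^ n) = nrm (x::'c) ^ n"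
  by (induction n) (auto simp: nrm_1 abs_mult)

lemma nrm_divide: "nrm (x / y) = nrm x / nrm (y::'c)"
proof (cases "y = 0")
  case False
  then show ?thesis
    using abs_mult[of "x / y" y] by (simp add: field_simps)
qed simp

lemma nrm_add_eq:
  assumes "nrm y < nrm (x::'c)"
  shows "nrm (x + y) = nrm x"
proof -
  have "nrm x \<le> max (nrm (x + y)) (nrm y)"
    using nrm_diff_le[of "x + y" y] by simp
  with assms abs_add[of x y] show ?thesis
    by simp
qed

lemma nrm_add_max:
  assumes "nrm x \<noteq> nrm (y::'c)"
  shows "nrm (x + y) = max (nrm x) (nrm y)"
proof (cases "nrm y < nrm x")
  case True
  then show ?thesis
    by (simp add: nrm_add_eq)
next
  case False
  then show ?thesis
    using assms nrm_add_eq[of x y] by (simp add: add.commute)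
qed

lemma nrm_sum_le:
  fixes f :: "'b \<Rightarrow> 'c"
  assumes "\<And>x. x \<in> F \<Longrightarrow> nrm (f x) \<le> B" "0 \<le> B"
  shows "nrm (sum f F) \<le> B"
  using assms(1)
proof (induction F rule: infinite_finite_induct)
  case (insert x F)
  then show ?case
    using abs_add[of "f x" "sum f F"] by fastforce
qed (use assms(2) in auto)

lemma nrm_prod: "nrm (prod f F) = (\<Prod>x\<in>F. nrm (f x :: 'c))"
  by (induction F rule: infinite_finite_induct) (auto simp: nrm_1 abs_mult)

text \<open>Induction through \<open>(1 - y) P - 1 = (1 - y) (P - 1) - y\<close>. By the ultrametric
  inequality the errors do not accumulate, so the bound is independent of the number of
  factors.\<close>

lemma nrm_prod_diff_le:
  fixes y :: "'b \<Rightarrow> 'c"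
  assumes "finite F" "\<And>x. x \<in> F \<Longrightarrow> nrm (y x) \<le> \<epsilon>" "0 \<le> \<epsilon>" "\<epsilon> \<le> 1"
  shows "nrm ((\<Prod>x\<in>F. 1 - y x) - 1) \<le> \<epsilon>"
  using assms(1,2)
proof (induction F)
  case empty
  then show ?case
    using assms(3) by simp
next
  case (insert x F)
  let ?P = "\<Prod>x\<in>F. 1 - y x"
  have "nrm (1 - y x) \<le> 1"
    using nrm_diff_le[of 1 "y x"] insert.prems[of x] assms(4) by (simp add: nrm_1)
  then have "nrm ((1 - y x) * (?P - 1)) \<le> 1 * \<epsilon>"
    unfolding abs_mult using insert by (intro mult_mono) auto
  moreover have "nrm (y x) \<le> \<epsilon>"
    using insert by simp
  ultimately have "nrm ((1 - y x) * (?P - 1) - y x) \<le> \<epsilon>"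
    using nrm_diff_le[of "(1 - y x) * (?P - 1)" "y x"] by simp
  then show ?case
    using insert by (simp add: algebra_simps)
qed

lemma iota_0: "\<iota> 0 = 0"
  using hom_add[of 0 0] by (metis add.right_neutral add_cancel_left_right)

lemma of_A_pCons: "of_A \<iota> (pCons c a) = \<iota> (to_ac (fls_const c)) + \<iota> (to_ac fls_X_inv) * of_A \<iota> a"
  by (simp add: of_A_def map_poly_pCons hom_add hom_mult)

lemma of_A_0: "of_A \<iota> 0 = 0"
  by (simp add: of_A_def iota_0)

lemma of_A_const: "of_A \<iota> [:c:] = \<iota> (to_ac (fls_const c))"
  by (simp add: of_A_pCons of_A_0)

lemma of_A_add: "of_A \<iota> (a + b) = of_A \<iota> a + of_A \<iota> b"
  by (induction a b rule: poly_induct2)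
     (auto simp: of_A_pCons of_A_0 hom_add algebra_simps fls_plus_const[symmetric] simp del: fls_plus_const)

lemma of_A_smult: "of_A \<iota> (Polynomial.smult c a) = of_A \<iota> [:c:] * of_A \<iota> a"
  unfolding of_A_const
  by (induction a) (auto simp: of_A_pCons of_A_0 hom_mult algebra_simps fls_const_mult_const[symmetric]
      simp del: fls_const_mult_const)

lemma of_A_mult: "of_A \<iota> (a * b) = of_A \<iota> a * of_A \<iota> b"
proof (induction a)
  case (pCons c a)
  have "of_A \<iota> (pCons c a * b) = of_A \<iota> (Polynomial.smult c b) + of_A \<iota> (pCons 0 (a * b))"
    by (simp add: of_A_add)
  then show ?case
    by (simp add: of_A_smult of_A_const of_A_pCons of_A_0 pCons.IH iota_0 algebra_simps)
qed (simp add: of_A_0)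

lemma nrm_X: "nrm (\<iota> (to_ac fls_X_inv)) = real CARD('f)"
  by (simp add: abs_extends abs_infty_def)

lemma nrm_const: "nrm (\<iota> (to_ac (fls_const c))) = (if c = 0 then 0 else 1)"
  by (simp add: abs_extends abs_infty_def)

lemma nrm_of_A: "a \<noteq> 0 \<Longrightarrow> nrm (of_A \<iota> a) = real CARD('f) ^ Polynomial.degree a"
proof (induction a)
  case (pCons c a)
  show ?case
  proof (cases "a = 0")
    case True
    with pCons.hyps show ?thesis
      by (simp add: of_A_const nrm_const)
  next
    case False
    have "real CARD('f) > 1"
      using card_field_gt_1[where 'f = 'f] by simp
    then have "1 < real CARD('f) ^ Suc (Polynomial.degree a)"
      by (intro one_less_power) auto
    moreover have "nrm (\<iota> (to_ac fls_X_inv) * of_A \<iota> a) = real CARD('f) ^ Suc (Polynomial.degree a)"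
      using pCons.IH[OF False] by (simp add: abs_mult nrm_X)
    ultimately show ?thesis
      using False nrm_add_eq[of "\<iota> (to_ac (fls_const c))" "\<iota> (to_ac fls_X_inv) * of_A \<iota> a"]
      by (simp add: of_A_pCons nrm_const add.commute)
  qed
qed simp

end

text \<open>Nonzero polynomials have positive absolute value, which gives injectivity and makes all
  formal results available.\<close>

sublocale C_infty \<subseteq> poly_embedding "of_A \<iota>"
proof
  show "of_A \<iota> 1 = 1"
    using of_A_const[of 1] by (simp add: hom_one pCons_one)
  show "a = 0" if "of_A \<iota> a = 0" for a
    using nrm_of_A[of a] that by (cases "a = 0") (auto simp: card_gt_0_iff)
qed (simp_all add: of_A_add of_A_mult)

context C_infty
begin

lemma nrm_of_A': "a \<noteq> 0 \<Longrightarrow> nrm (of_A \<iota> a) = real q ^ Polynomial.degree a"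
  by (simp add: nrm_of_A q_def)

lemma nrm_of_A_ge_1: "a \<noteq> 0 \<Longrightarrow> nrm (of_A \<iota> a) \<ge> 1"
  using q_gt_1 by (simp add: nrm_of_A')

lemma has_sum_nrm_le:
  fixes f :: "'b \<Rightarrow> 'c"
  assumes "(f has_sum s) A" "\<And>x. x \<in> A \<Longrightarrow> nrm (f x) \<le> B" "0 \<le> B"
  shows "nrm s \<le> B"
proof (rule tendsto_upperbound)
  show "((\<lambda>F. nrm (sum f F)) \<longlongrightarrow> nrm s) (finite_subsets_at_top A)"
    using assms(1) unfolding has_sum_def by (intro tendsto_dist) auto
  show "eventually (\<lambda>F. nrm (sum f F) \<le> B) (finite_subsets_at_top A)"
    using assms(2,3) by (intro eventually_finite_subsets_at_top_weakI nrm_sum_le) auto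
qed simp

text \<open>A term strictly larger than a common bound for all others fixes the absolute value of
  every finite partial sum that contains it.\<close>

lemma has_sum_nrm_ge:
  fixes f :: "'b \<Rightarrow> 'c"
  assumes "(f has_sum s) A" "a \<in> A" "\<And>x. \<lbrakk>x \<in> A; x \<noteq> a\<rbrakk> \<Longrightarrow> nrm (f x) \<le> B" "0 \<le> B" "B < nrm (f a)"
  shows "nrm (f a) \<le> nrm s"
proof (rule tendsto_lowerbound)
  show "((\<lambda>F. nrm (sum f F)) \<longlongrightarrow> nrm s) (finite_subsets_at_top A)"
    using assms(1) unfolding has_sum_def by (intro tendsto_dist) auto
  have "nrm (f a) \<le> nrm (sum f F)" if "finite F" "{a} \<subseteq> F" "F \<subseteq> A" for F
  proof -
    have "nrm (sum f (F - {a})) \<le> B"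
      using assms that by (intro nrm_sum_le) auto
    moreover have "sum f F = f a + sum f (F - {a})"
      using that by (intro sum.remove) auto
    ultimately show ?thesis
      using assms(5) nrm_add_eq[of "sum f (F - {a})" "f a"] by simp
  qed
  then show "eventually (\<lambda>F. nrm (f a) \<le> nrm (sum f F)) (finite_subsets_at_top A)"
    unfolding eventually_finite_subsets_at_top using assms(2) by (intro exI[of _ "{a}"]) auto
qed simp

subsection \<open>Polynomials near the origin\<close>

lemma poly_bounded:
  fixes p :: "'c poly"
  obtains B where "0 \<le> B" "\<And>x. nrm x \<le> 1 \<Longrightarrow> nrm (poly p x) \<le> B"
proof -
  have "\<exists>B\<ge>0. \<forall>x. nrm x \<le> 1 \<longrightarrow> nrm (poly p x) \<le> B"
  proof (induction p)
    case (pCons c p)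
    then obtain B where B: "0 \<le> B" "\<And>x. nrm x \<le> 1 \<Longrightarrow> nrm (poly p x) \<le> B"
      by blast
    have "nrm (poly (pCons c p) x) \<le> max (nrm c) B" if "nrm x \<le> 1" for x
    proof -
      have "nrm (x * poly p x) \<le> 1 * B"
        unfolding abs_mult using that B by (intro mult_mono) auto
      then show ?thesis
        using abs_add[of c "x * poly p x"] by simp
    qed
    with B(1) show ?case
      by (intro exI[of _ "max (nrm c) B"]) auto
  qed auto
  with that show ?thesis
    by blast
qed

lemma poly_0_eq_0:
  fixes p :: "'c poly"
  assumes "\<And>\<delta>. \<delta> > 0 \<Longrightarrow> \<exists>x. nrm x < \<delta> \<and> nrm (poly p x) < \<delta>"
  shows "poly p 0 = 0"
proof -
  obtain c p' where p: "p = pCons c p'"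
    by (cases p)
  obtain B where B: "0 \<le> B" "\<And>x. nrm x \<le> 1 \<Longrightarrow> nrm (poly p' x) \<le> B"
    using poly_bounded[of p'] by blast
  have "c = 0"
  proof (rule ccontr)
    assume "c \<noteq> 0"
    \<comment> \<open>Chosen so that both \<open>x * poly p' x\<close> and \<open>poly p x\<close>
      become smaller than \<open>c\<close>, although \<open>c\<close> is their difference.\<close>
    define \<delta> where "\<delta> = min 1 (nrm c / (B + 1))"
    have "\<delta> > 0"
      using \<open>c \<noteq> 0\<close> B by (simp add: \<delta>_def)
    then obtain x where x: "nrm x < \<delta>" "nrm (poly p x) < \<delta>"
      using assms by blast
    have le: "\<delta> \<le> 1" "\<delta> * (B + 1) \<le> nrm c"
      using B by (auto simp: \<delta>_def pos_le_divide_eq[symmetric])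
    have "nrm (x * poly p' x) \<le> nrm x * B"
      unfolding abs_mult using x le B by (intro mult_left_mono) auto
    also have "\<dots> \<le> nrm x * (B + 1)"
      by (intro mult_left_mono) auto
    also have "\<dots> < \<delta> * (B + 1)"
      using x B by (intro mult_strict_right_mono) auto
    finally have "nrm (x * poly p' x) < nrm c"
      using le by simp
    moreover have "nrm (poly p x) < nrm c"
    proof -
      have "\<delta> * 1 \<le> \<delta> * (B + 1)"
        using \<open>\<delta> > 0\<close> B by (intro mult_left_mono) auto
      with x le show ?thesis
        by simp
    qed
    ultimately show False
      using nrm_diff_le[of "poly p x" "x * poly p' x"] by (simp add: p)
  qed
  then show ?thesis
    by (simp add: p)
qed

text \<open>The bound forces a zero at the origin. Dividing \<open>p\<close> by the variable lowers
  the exponent by one; this requires test points \<open>x \<noteq> 0\<close>.\<close>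

lemma coeff_eq_0_of_bound:
  fixes p :: "'c poly"
  assumes "\<And>\<delta>. \<delta> > 0 \<Longrightarrow> \<exists>x. x \<noteq> 0 \<and> nrm x < \<delta> \<and> nrm (poly p x) \<le> M * nrm x ^ N" "0 \<le> M" "k < N"
  shows "Polynomial.coeff p k = 0"
  using assms
proof (induction N arbitrary: p k)
  case (Suc N)
  have "poly p 0 = 0"
  proof (rule poly_0_eq_0)
    fix \<delta> :: real assume "\<delta> > 0"
    define \<delta>' where "\<delta>' = min 1 (\<delta> / (M + 1))"
    have "\<delta>' > 0"
      using \<open>\<delta> > 0\<close> Suc.prems by (simp add: \<delta>'_def)
    then obtain x where x: "nrm x < \<delta>'" "nrm (poly p x) \<le> M * nrm x ^ Suc N"
      using Suc.prems(1) by blast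
    have \<delta>': "\<delta>' \<le> 1" "\<delta>' * (M + 1) \<le> \<delta>"
      using Suc.prems by (auto simp: \<delta>'_def pos_le_divide_eq[symmetric])
    have "nrm x ^ Suc N \<le> nrm x ^ 1"
      using x \<delta>' by (intro power_decreasing) auto
    then have "M * nrm x ^ Suc N \<le> M * nrm x"
      using Suc.prems by (intro mult_left_mono) auto
    moreover have "nrm x * (M + 1) < \<delta>' * (M + 1)"
      using x Suc.prems by (intro mult_strict_right_mono) auto
    moreover have "0 \<le> M * nrm x"
      using Suc.prems by simp
    moreover have "nrm x * (M + 1) = M * nrm x + nrm x"
      by (simp add: algebra_simps)
    ultimately have "nrm x < \<delta>" "nrm (poly p x) < \<delta>"
      using x \<delta>' zero_le_dist[of x 0] by linarith+
    then show "\<exists>x. nrm x < \<delta> \<and> nrm (poly p x) < \<delta>"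
      by blast
  qed
  then obtain p' where p: "p = pCons 0 p'"
    by (cases p) simp
  have "Polynomial.coeff p' k = 0" if "k < N" for k
  proof (rule Suc.IH[OF _ _ that])
    fix \<delta> :: real assume "\<delta> > 0"
    then obtain x where x: "x \<noteq> 0" "nrm x < \<delta>" "nrm (poly p x) \<le> M * nrm x ^ Suc N"
      using Suc.prems(1) by blast
    then have "nrm x * nrm (poly p' x) \<le> nrm x * (M * nrm x ^ N)"
      by (simp add: p abs_mult mult.left_commute)
    then have "nrm (poly p' x) \<le> M * nrm x ^ N"
      using x(1) by simp
    with x show "\<exists>x. x \<noteq> 0 \<and> nrm x < \<delta> \<and> nrm (poly p' x) \<le> M * nrm x ^ N"
      by blast
  qed (use Suc.prems in simp)
  then show ?case
    using Suc.prems(3) by (cases k) (auto simp: p)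
qed simp

subsection \<open>The exponential away from the circles through lattice points\<close>

text \<open>For such \<open>z\<close> no cancellation occurs in \<open>z + a\<close> or
  \<open>1 - z / a\<close>, so the ultrametric inequality becomes an equality. The case
  \<open>a = 0\<close> excludes \<open>z = 0\<close>.\<close>

definition generic :: "'c \<Rightarrow> bool" where
  "generic z \<longleftrightarrow> (\<forall>a. nrm z \<noteq> nrm (of_A \<iota> a))"

lemma generic_not_A: "generic z \<Longrightarrow> z \<notin> range (of_A \<iota>)"
  by (auto simp: generic_def)

lemma generic_neq_0: "generic z \<Longrightarrow> z \<noteq> 0"
  using generic_not_A rho_0 by (metis rangeI)

lemma generic_nrm_add: "generic z \<Longrightarrow> nrm z \<le> nrm (z + of_A \<iota> b)"
  using nrm_add_max[of z "of_A \<iota> b"] by (simp add: generic_def)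

text \<open>A square root of an odd power of \<open>T\<close> works: its absolute value is a
  half-integral power of q, whereas nonzero elements of A have integral ones.\<close>

lemma ex_generic:
  obtains z where "generic z" "nrm z \<ge> R"
proof -
  obtain k where k: "R \<le> real k"
    using real_arch_simple by blast
  obtain u :: "'f fls alg_closure" where u: "u ^ 2 = to_ac (fls_X_inv ^ (2 * k + 1))"
    using nth_root_exists[of 2] by auto
  define z where "z = \<iota> u"
  have "z ^ 2 = \<iota> (u ^ 2)"
    by (simp add: z_def power2_eq_square hom_mult)
  also have "nrm \<dots> = real q ^ (2 * k + 1)"
    unfolding u abs_extends abs_infty_def fls_subdegree_fls_X_inv_pow minus_minus power_int_of_nat
    by (simp add: q_def)
  finally have z: "nrm z ^ 2 = real q ^ (2 * k + 1)"
    by (simp add: nrm_power)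
  have "generic z"
    unfolding generic_def
  proof
    fix a
    show "nrm z \<noteq> nrm (of_A \<iota> a)"
    proof
      assume eq: "nrm z = nrm (of_A \<iota> a)"
      then have "a \<noteq> 0"
        using z q_pos by (auto simp: rho_0)
      then have "real q ^ (Polynomial.degree a * 2) = real q ^ (2 * k + 1)"
        using z eq by (simp add: nrm_of_A' power_mult[symmetric])
      then have "Polynomial.degree a * 2 = 2 * k + 1"
        using q_gt_1 power_inject_exp[of "real q" "Polynomial.degree a * 2" "2 * k + 1"] by simp
      then show False
        by presburger
    qed
  qed
  moreover have "real k \<le> nrm z"
  proof -
    have "2 ^ k \<le> real q ^ k"
      using q_gt_1 by (intro power_mono) auto
    then have "real k \<le> real q ^ k"
      using of_nat_less_two_power[of k, where 'a = real] by linarith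
    moreover have "(real q ^ k) ^ 2 \<le> nrm z ^ 2"
      unfolding z power_mult[symmetric] using q_gt_1 by (intro power_increasing) auto
    then have "real q ^ k \<le> nrm z"
      by (rule power2_le_imp_le) simp
    ultimately show ?thesis
      by linarith
  qed
  ultimately show ?thesis
    using that k by force
qed

text \<open>Every factor of the product has absolute value
  \<open>max 1 (nrm (\<pi> * z / v)) \<ge> 1\<close>, hence so has every finite product. Most of the
  proof shows that the net converges, without which the value of \<open>Lim\<close> would carry no
  information.\<close>

lemma lattice_exp_ge:
  assumes "\<pi> \<noteq> 0" "generic z"
  shows "nrm (\<pi> * z) \<le> nrm (lattice_exp (lattice \<iota> \<pi>) (\<pi> * z))"
proof -
  define \<Lambda> where "\<Lambda> = lattice \<iota> \<pi> - {0}"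
  define P where "P F = (\<Prod>v\<in>F. 1 - \<pi> * z / v)" for F
  \<comment> \<open>The sets \<open>S D\<close> exhaust the nonzero lattice points, and
    \<open>\<epsilon> D\<close> bounds \<open>\<pi> * z / v\<close> outside
    \<open>S D\<close>.\<close>
  define S where "S D = (\<lambda>b. \<pi> * of_A \<iota> b) ` ({b. Polynomial.degree b \<le> D} - {0})" for D
  define \<epsilon> where "\<epsilon> D = nrm z / real q ^ D" for D
  have \<Lambda>: "\<exists>b. b \<noteq> 0 \<and> v = \<pi> * of_A \<iota> b" if "v \<in> \<Lambda>" for v
  proof -
    obtain b where "v = \<pi> * of_A \<iota> b" "v \<noteq> 0"
      using \<open>v \<in> \<Lambda>\<close> by (auto simp: \<Lambda>_def lattice_def)
    then show ?thesis
      by (intro exI[of _ b]) (auto simp: rho_0)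
  qed
  have ne: "nrm (\<pi> * z / v) \<noteq> 1" if "v \<in> \<Lambda>" for v
  proof -
    obtain b where b: "b \<noteq> 0" "v = \<pi> * of_A \<iota> b"
      using \<Lambda>[OF \<open>v \<in> \<Lambda>\<close>] by blast
    then have "nrm (of_A \<iota> b) \<noteq> 0"
      using rho_eq_0D by auto
    then have "nrm (\<pi> * z / v) = 1 \<longleftrightarrow> nrm z = nrm (of_A \<iota> b)"
      using assms(1) by (auto simp: b(2) nrm_divide abs_mult)
    then show ?thesis
      using assms(2) by (simp add: generic_def)
  qed
  then have max: "nrm (1 - \<pi> * z / v) = max 1 (nrm (\<pi> * z / v))" if "v \<in> \<Lambda>" for v
    using nrm_add_max[of 1 "- (\<pi> * z / v)"] that by (simp add: nrm_1 nrm_minus)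
  have S: "finite (S D)" "S D \<subseteq> \<Lambda>" for D
    using assms(1) rho_eq_0D by (auto simp: S_def \<Lambda>_def lattice_def finite_degree_le)
  have S_mono: "S D \<subseteq> S D'" if "D \<le> D'" for D D'
    using that by (auto simp: S_def)
  have tail: "nrm (\<pi> * z / v) \<le> \<epsilon> D" if "v \<in> \<Lambda> - S D" for v D
  proof -
    obtain b where b: "b \<noteq> 0" "v = \<pi> * of_A \<iota> b"
      using \<Lambda> \<open>v \<in> \<Lambda> - S D\<close> by blast
    then have "D \<le> Polynomial.degree b"
      using that by (force simp: S_def)
    then have "real q ^ D \<le> real q ^ Polynomial.degree b"
      using q_gt_1 by (intro power_increasing) auto
    then show ?thesis
      using b assms(1) q_gt_1 by (simp add: nrm_divide nrm_of_A' \<epsilon>_def frac_le)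
  qed
  have \<epsilon>0: "\<epsilon> \<longlonglongrightarrow> 0"
    unfolding \<epsilon>_def using q_gt_1 by (intro LIMSEQ_divide_realpow_zero) simp
  have \<epsilon>_nonneg: "0 \<le> \<epsilon> D" for D
    by (simp add: \<epsilon>_def)
  \<comment> \<open>Beyond \<open>S D0\<close> every factor has absolute value 1, so the products
    over \<open>S D\<close> share the absolute value \<open>C\<close>.\<close>
  obtain D0 where D0: "\<epsilon> D < 1" if "D \<ge> D0" for D
    using order_tendstoD(2)[OF \<epsilon>0, of 1] by (auto simp: eventually_sequentially)
  define C where "C = nrm (P (S D0))"
  have split: "P F = P (S D) * P (F - S D)" if "finite F" "S D \<subseteq> F" for F D
    unfolding P_def using that S(1)[of D] by (subst prod.subset_diff[of "S D" F]) (auto simp: mult.commute)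
  have nrm_P: "nrm (P (S D)) = C" if "D \<ge> D0" for D
  proof -
    have "nrm (P (S D - S D0)) = 1"
      unfolding P_def nrm_prod
    proof (rule prod.neutral, rule ballI)
      fix v assume "v \<in> S D - S D0"
      then have v: "v \<in> \<Lambda> - S D0"
        using S(2) by blast
      then have "nrm (\<pi> * z / v) \<le> 1"
        using tail[OF v] D0[of D0] by simp
      then show "nrm (1 - \<pi> * z / v) = 1"
        using max v by simp
    qed
    then show ?thesis
      using split[OF S(1) S_mono[OF that]] by (simp add: C_def abs_mult)
  qed
  have close: "dist (P F) (P (S D)) \<le> C * \<epsilon> D" if "D \<ge> D0" "finite F" "S D \<subseteq> F" "F \<subseteq> \<Lambda>" for D F
  proof -
    have "P F - P (S D) = P (S D) * (P (F - S D) - 1)"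
      by (subst split[OF that(2,3)]) (simp add: algebra_simps)
    moreover have "nrm (P (F - S D) - 1) \<le> \<epsilon> D"
      unfolding P_def using that D0[of D] \<epsilon>_nonneg[of D]
      by (intro nrm_prod_diff_le tail) auto
    ultimately show ?thesis
      using nrm_P[OF that(1)] dist_diff[of "P F" "P (S D)"] by (simp add: abs_mult mult_left_mono C_def)
  qed
  have small: "\<exists>D\<ge>D0. \<forall>D'\<ge>D. C * \<epsilon> D' < e" if "e > 0" for e
  proof -
    have "(\<lambda>D. C * \<epsilon> D) \<longlonglongrightarrow> C * 0"
      by (intro tendsto_mult \<epsilon>0 tendsto_const)
    then have "eventually (\<lambda>D. C * \<epsilon> D < e) sequentially"
      using that by (intro order_tendstoD(2)[of _ 0]) auto
    then obtain D1 where "\<forall>D\<ge>D1. C * \<epsilon> D < e"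
      by (auto simp: eventually_sequentially)
    then show ?thesis
      by (intro exI[of _ "max D0 D1"]) auto
  qed
  have "Cauchy (\<lambda>D. P (S D))"
  proof (rule metric_CauchyI)
    fix e :: real assume "e > 0"
    then obtain D where D: "D \<ge> D0" "C * \<epsilon> D < e / 2"
      using small[of "e / 2"] by auto
    have "dist (P (S m)) (P (S D)) < e / 2" if "m \<ge> D" for m
      using close[OF D(1) S(1) S_mono[OF that] S(2)] D(2) by linarith
    then have "dist (P (S m)) (P (S n)) < e" if "m \<ge> D" "n \<ge> D" for m n
      using that by (metis dist_triangle_half_l)
    then show "\<exists>M. \<forall>m\<ge>M. \<forall>n\<ge>M. dist (P (S m)) (P (S n)) < e"
      by blast
  qed
  then obtain L where L: "(\<lambda>D. P (S D)) \<longlonglongrightarrow> L"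
    using Cauchy_convergent convergent_def by blast
  \<comment> \<open>\<open>close\<close> upgrades convergence along the sequence \<open>S D\<close>
    to convergence over all finite subsets.\<close>
  have lim: "(P \<longlongrightarrow> L) (finite_subsets_at_top \<Lambda>)"
  proof (rule tendstoI)
    fix e :: real assume "e > 0"
    then obtain D1 where D1: "D1 \<ge> D0" "\<forall>D\<ge>D1. C * \<epsilon> D < e / 2"
      using small[of "e / 2"] by auto
    obtain D2 where D2: "\<forall>D\<ge>D2. dist (P (S D)) L < e / 2"
      using tendstoD[OF L, of "e / 2"] \<open>e > 0\<close> by (auto simp: eventually_sequentially)
    define D where "D = max D1 D2"
    have "dist (P F) L < e" if "finite F" "S D \<subseteq> F" "F \<subseteq> \<Lambda>" for F
    proof -
      have "dist (P F) (P (S D)) \<le> C * \<epsilon> D"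
        using D1(1) that by (intro close) (auto simp: D_def)
      moreover have "C * \<epsilon> D < e / 2" "dist (P (S D)) L < e / 2"
        using D1(2) D2 by (auto simp: D_def)
      ultimately show ?thesis
        using dist_triangle[of "P F" L "P (S D)"] by linarith
    qed
    then show "eventually (\<lambda>F. dist (P F) L < e) (finite_subsets_at_top \<Lambda>)"
      unfolding eventually_finite_subsets_at_top using S[of D] by (intro exI[of _ "S D"]) auto
  qed
  have "1 \<le> nrm L"
  proof (rule tendsto_lowerbound)
    show "((\<lambda>F. nrm (P F)) \<longlongrightarrow> nrm L) (finite_subsets_at_top \<Lambda>)"
      by (intro tendsto_dist lim tendsto_const)
    show "eventually (\<lambda>F. 1 \<le> nrm (P F)) (finite_subsets_at_top \<Lambda>)"
      unfolding P_def nrm_prod using max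
      by (intro eventually_finite_subsets_at_top_weakI prod_ge_1) auto
  qed simp
  moreover have "lattice_exp (lattice \<iota> \<pi>) (\<pi> * z) = \<pi> * z * Lim (finite_subsets_at_top \<Lambda>) P"
    unfolding lattice_exp_def \<Lambda>_def P_def ..
  moreover have "Lim (finite_subsets_at_top \<Lambda>) P = L"
    by (rule tendsto_Lim[OF _ lim]) simp
  ultimately show ?thesis
    using mult_left_mono[of 1 "nrm L" "nrm (\<pi> * z)"] by (simp add: abs_mult)
qed

text \<open>By \<open>lattice_exp_ge\<close>, \<open>t(z)\<close> is at most
  \<open>1 / nrm (\<pi> * z)\<close>, so large generic \<open>z\<close> are suitable.\<close>

lemma small_t_param:
  assumes "\<pi> \<noteq> 0" "\<delta> > 0"
  obtains z where "generic z" "t_param \<iota> \<pi> z \<noteq> 0" "nrm (t_param \<iota> \<pi> z) < \<delta>" "1 / nrm (\<pi> * z) < \<delta>"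
proof -
  obtain z where z: "generic z" "nrm z \<ge> 1 / (\<delta> * nrm \<pi>) + 1"
    using ex_generic .
  have "nrm \<pi> > 0"
    using assms by simp
  then have "nrm \<pi> * (1 / (\<delta> * nrm \<pi>)) < nrm \<pi> * nrm z"
    using z(2) by (intro mult_strict_left_mono) auto
  then have "1 / \<delta> < nrm \<pi> * nrm z"
    using \<open>nrm \<pi> > 0\<close> by simp
  then have lt: "1 / nrm (\<pi> * z) < \<delta>"
    using assms(2) \<open>nrm \<pi> > 0\<close> generic_neq_0[OF z(1)] by (simp add: abs_mult field_simps)
  have le: "nrm (\<pi> * z) \<le> nrm (lattice_exp (lattice \<iota> \<pi>) (\<pi> * z))"
    by (rule lattice_exp_ge[OF assms(1) z(1)])
  have pos: "nrm (\<pi> * z) > 0"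
    using assms(1) generic_neq_0[OF z(1)] by simp
  have "t_param \<iota> \<pi> z \<noteq> 0"
    using le pos by (auto simp: t_param_def)
  moreover have "nrm (t_param \<iota> \<pi> z) \<le> 1 / nrm (\<pi> * z)"
    using le pos by (simp add: t_param_def nrm_divide nrm_1 frac_le)
  ultimately show ?thesis
    using that[OF z(1)] lt by simp
qed

text \<open>For generic \<open>z\<close> no \<open>z + b\<close> is smaller than \<open>z\<close>,
  so the lattice sum is at most \<open>(1 / nrm (\<pi> * z)) ^ n\<close>. It tends to 0 together
  with \<open>t(z)\<close> as \<open>z\<close> grows.\<close>

lemma goss_poly_0:
  assumes "\<pi> \<noteq> 0" "n > 0" and G: "is_goss_poly \<iota> \<pi> n G"
  shows "poly G 0 = 0"
proof (rule poly_0_eq_0)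
  fix \<delta> :: real assume "\<delta> > 0"
  then obtain z where z: "generic z" "nrm (t_param \<iota> \<pi> z) < min \<delta> 1" "1 / nrm (\<pi> * z) < min \<delta> 1"
    using small_t_param[OF assms(1), of "min \<delta> 1"] by auto
  have pos: "nrm (\<pi> * z) > 0"
    using assms(1) generic_neq_0[OF z(1)] by simp
  have "nrm (poly G (t_param \<iota> \<pi> z)) \<le> (1 / nrm (\<pi> * z)) ^ n"
  proof (rule has_sum_nrm_le)
    show "((\<lambda>b. 1 / (\<pi> * z + \<pi> * of_A \<iota> b) ^ n) has_sum poly G (t_param \<iota> \<pi> z)) UNIV"
      using G generic_not_A[OF z(1)] by (simp add: is_goss_poly_def)
    fix b
    have "nrm (\<pi> * z) \<le> nrm (\<pi> * z + \<pi> * of_A \<iota> b)"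
      using generic_nrm_add[OF z(1), of b]
      by (simp add: distrib_left[symmetric] abs_mult mult_left_mono)
    then have "1 / nrm (\<pi> * z + \<pi> * of_A \<iota> b) \<le> 1 / nrm (\<pi> * z)"
      using pos by (simp add: frac_le)
    then have "(1 / nrm (\<pi> * z + \<pi> * of_A \<iota> b)) ^ n \<le> (1 / nrm (\<pi> * z)) ^ n"
      by (intro power_mono) auto
    then show "nrm (1 / (\<pi> * z + \<pi> * of_A \<iota> b) ^ n) \<le> (1 / nrm (\<pi> * z)) ^ n"
      by (simp add: nrm_divide nrm_1 nrm_power power_divide)
  qed simp
  also have "\<dots> \<le> (1 / nrm (\<pi> * z)) ^ 1"
    using z(3) assms(2) by (intro power_decreasing) auto
  finally show "\<exists>x. nrm x < \<delta> \<and> nrm (poly G x) < \<delta>"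
    using z by (intro exI[of _ "t_param \<iota> \<pi> z"]) auto
qed

text \<open>For \<open>|z| < 1\<close> the term \<open>b = 0\<close> dominates the lattice sum.\<close>

lemma goss_poly_neq_0:
  assumes "\<pi> \<noteq> 0" "n > 0" and G: "is_goss_poly \<iota> \<pi> n G"
  shows "G \<noteq> 0"
proof -
  \<comment> \<open>This is \<open>1/T\<close>, of absolute value \<open>1/q\<close>.\<close>
  define z where "z = \<iota> (to_ac fls_X)"
  have "nrm z = 1 / real q"
    by (simp add: z_def abs_extends abs_infty_def q_def power_int_minus divide_inverse)
  then have z: "0 < nrm z" "nrm z < 1"
    using q_gt_1 by auto
  let ?f = "\<lambda>b. 1 / (\<pi> * z + \<pi> * of_A \<iota> b) ^ n"
  have "z \<notin> range (of_A \<iota>)"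
  proof
    assume "z \<in> range (of_A \<iota>)"
    then obtain a where "z = of_A \<iota> a"
      by blast
    then show False
      using z nrm_of_A_ge_1[of a] by (cases "a = 0") (auto simp: rho_0)
  qed
  then have sum: "(?f has_sum poly G (t_param \<iota> \<pi> z)) UNIV"
    using G by (simp add: is_goss_poly_def)
  have f0: "nrm (?f 0) = 1 / (nrm \<pi> * nrm z) ^ n"
    by (simp add: rho_0 nrm_divide nrm_1 nrm_power abs_mult)
  have "nrm (?f 0) \<le> nrm (poly G (t_param \<iota> \<pi> z))"
  proof (rule has_sum_nrm_ge[OF sum])
    fix b :: "'f poly" assume "b \<noteq> 0"
    then have b: "1 \<le> nrm (of_A \<iota> b)"
      by (rule nrm_of_A_ge_1)
    then have "nrm (of_A \<iota> b + z) = nrm (of_A \<iota> b)"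
      using z by (intro nrm_add_eq) simp
    then have "nrm \<pi> * 1 \<le> nrm (\<pi> * z + \<pi> * of_A \<iota> b)"
      unfolding distrib_left[symmetric] abs_mult using b
      by (intro mult_left_mono) (auto simp: add.commute)
    then have "nrm \<pi> ^ n \<le> nrm (\<pi> * z + \<pi> * of_A \<iota> b) ^ n"
      by (intro power_mono) auto
    then show "nrm (?f b) \<le> 1 / nrm \<pi> ^ n"
      using assms(1) by (simp add: nrm_divide nrm_1 nrm_power frac_le)
  next
    have "nrm \<pi> * nrm z < nrm \<pi> * 1"
      using assms(1) z by (intro mult_strict_left_mono) auto
    then have "(nrm \<pi> * nrm z) ^ n < nrm \<pi> ^ n"
      using assms(2) by (intro power_strict_mono) auto
    then show "1 / nrm \<pi> ^ n < nrm (?f 0)"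
      unfolding f0 using assms(1) z by (intro divide_strict_left_mono) auto
  qed auto
  moreover have "nrm (?f 0) > 0"
    unfolding f0 using assms(1) z by simp
  ultimately show ?thesis
    by auto
qed

section \<open>The series of t_a from its analytic characterisation\<close>

lemma carlitz_eq: "carlitz \<iota> a x = (\<Sum>i\<le>Polynomial.degree a. carlitz_coeff a i * x ^ q ^ i)"
  unfolding carlitz_def T_def[symmetric] q_def[symmetric]
  by (rule carlitz_sum[OF frobenius_base, of "\<lambda>x. x"]) simp_all

text \<open>Convergence at \<open>x0\<close> bounds all terms there by some \<open>B\<close>. In the
  ultrametric setting the tail from \<open>N\<close> on is then at most
  \<open>B * (nrm x / nrm x0) ^ N\<close>, uniformly in \<open>x\<close>.\<close>

lemma sums_tail_bound:
  fixes P :: "'c fps"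
  assumes "(\<lambda>k. fps_nth P k * x0 ^ k) sums y0" "x0 \<noteq> 0"
  obtains M where "0 \<le> M" "\<And>x y. \<lbrakk>(\<lambda>k. fps_nth P k * x ^ k) sums y; nrm x \<le> nrm x0\<rbrakk> \<Longrightarrow>
    dist (\<Sum>k<N. fps_nth P k * x ^ k) y \<le> M * nrm x ^ N"
proof -
  let ?S = "\<lambda>x m. \<Sum>k<m. fps_nth P k * x ^ k"
  have "bounded (range (?S x0))"
    using assms(1) unfolding sums_def by (rule convergent_imp_bounded)
  then obtain B where B: "\<And>m. dist 0 (?S x0 m) \<le> B"
    using bounded_any_center[of "range (?S x0)" 0] by auto
  have B0: "0 \<le> B"
    using B[of 0] by simp
  have term0: "nrm (fps_nth P k) * nrm x0 ^ k \<le> B" for k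
  proof -
    have "fps_nth P k * x0 ^ k = ?S x0 (Suc k) - ?S x0 k"
      by simp
    then have "nrm (fps_nth P k * x0 ^ k) \<le> B"
      using nrm_diff_le[of "?S x0 (Suc k)" "?S x0 k"] B[of k] B[of "Suc k"]
      by (simp add: dist_commute del: sum.lessThan_Suc)
    then show ?thesis
      by (simp add: abs_mult nrm_power)
  qed
  define M where "M = B / nrm x0 ^ N"
  have "dist (?S x N) y \<le> M * nrm x ^ N"
    if sums: "(\<lambda>k. fps_nth P k * x ^ k) sums y" and le: "nrm x \<le> nrm x0" for x y
  proof (rule tendsto_upperbound)
    show "(\<lambda>m. dist (?S x N) (?S x m)) \<longlonglongrightarrow> dist (?S x N) y"
      using sums unfolding sums_def by (intro tendsto_dist tendsto_const)
    have "dist (?S x N) (?S x m) \<le> M * nrm x ^ N" if "m \<ge> N" for m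
    proof -
      have "?S x m - ?S x N = (\<Sum>k\<in>{N..<m}. fps_nth P k * x ^ k)"
        using sum_diff_nat_ivl[of 0 N m "\<lambda>k. fps_nth P k * x ^ k"] that
        by (simp add: lessThan_atLeast0)
      moreover have "nrm (\<Sum>k\<in>{N..<m}. fps_nth P k * x ^ k) \<le> M * nrm x ^ N"
      proof (rule nrm_sum_le)
        fix k assume "k \<in> {N..<m}"
        then have k: "k = N + (k - N)"
          by simp
        have "nrm x ^ k * nrm x0 ^ N = nrm x ^ N * nrm x0 ^ N * nrm x ^ (k - N)"
          by (subst k) (simp add: power_add)
        also have "\<dots> \<le> nrm x ^ N * nrm x0 ^ N * nrm x0 ^ (k - N)"
          using le by (intro mult_left_mono power_mono) auto
        also have "\<dots> = nrm x ^ N * nrm x0 ^ k"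
          by (subst (2) k) (simp add: power_add)
        finally have "nrm (fps_nth P k) * (nrm x ^ k * nrm x0 ^ N) \<le>
            nrm (fps_nth P k) * (nrm x ^ N * nrm x0 ^ k)"
          by (intro mult_left_mono) auto
        also have "\<dots> = (nrm (fps_nth P k) * nrm x0 ^ k) * nrm x ^ N"
          by simp
        also have "\<dots> \<le> B * nrm x ^ N"
          by (intro mult_right_mono term0) auto
        finally show "nrm (fps_nth P k * x ^ k) \<le> M * nrm x ^ N"
          using assms(2) by (simp add: M_def abs_mult nrm_power field_simps)
      qed (simp add: M_def B0)
      ultimately show ?thesis
        using dist_diff[of "?S x m" "?S x N"] by (simp add: dist_commute)
    qed
    then show "eventually (\<lambda>m. dist (?S x N) (?S x m) \<le> M * nrm x ^ N) sequentially"
      by (auto simp: eventually_sequentially)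
  qed simp
  then show ?thesis
    using that[of M] B0 by (simp add: M_def)
qed

text \<open>With \<open>x = t(z)\<close> the functional equation gives
  \<open>D(x) t(a z) = x ^ Q\<close> pointwise. Replacing \<open>t(a z)\<close> by a truncation of
  \<open>P\<close> leaves an error of order \<open>x ^ N\<close> at arbitrarily small nonzero
  \<open>x\<close>, so the coefficients below \<open>N\<close> agree.\<close>

lemma t_expansion_eq:
  assumes "carlitz_period \<iota> \<pi>" "a \<in> A_plus" "is_t_expansion \<iota> \<pi> a P"
  shows "P * t_denom a = fps_X ^ q ^ Polynomial.degree a"
proof -
  define Q where "Q = q ^ Polynomial.degree a"
  define D where "D = (\<Sum>i\<le>Polynomial.degree a. monom (carlitz_coeff a i) (Q - q ^ i))"
  have D: "t_denom a = fps_of_poly D"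
    by (simp add: t_denom_def D_def Q_def fps_of_poly_sum fps_of_poly_monom)
  have \<pi>: "\<pi> \<noteq> 0"
    using assms(1) by (simp add: carlitz_period_def)
  have D0: "poly D 0 = 1"
    using t_denom_0[OF assms(2)] by (simp add: D poly_0_coeff_0)
  obtain r where r: "r > 0" "\<And>z. \<lbrakk>z \<notin> range (of_A \<iota>); nrm (t_param \<iota> \<pi> z) < r\<rbrakk> \<Longrightarrow>
      (\<lambda>k. fps_nth P k * t_param \<iota> \<pi> z ^ k) sums t_param \<iota> \<pi> (of_A \<iota> a * z)"
    using assms(3) by (auto simp: is_t_expansion_def)
  obtain BD where BD: "0 \<le> BD" "\<And>x. nrm x \<le> 1 \<Longrightarrow> nrm (poly D x) \<le> BD"
    using poly_bounded[of D] by blast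
  have D_t: "poly D x * t_param \<iota> \<pi> (of_A \<iota> a * z) = x ^ Q"
    if x: "x = t_param \<iota> \<pi> z" "x \<noteq> 0" "poly D x \<noteq> 0" for x z
  proof -
    have e: "lattice_exp (lattice \<iota> \<pi>) (\<pi> * z) = 1 / x"
      by (simp add: x(1) t_param_def)
    have "t_param \<iota> \<pi> (of_A \<iota> a * z) = 1 / carlitz \<iota> a (1 / x)"
      using assms(1) unfolding carlitz_period_def e[symmetric] t_param_def by (metis mult.left_commute)
    moreover have "x ^ Q * carlitz \<iota> a (1 / x) = poly D x"
      unfolding carlitz_eq D_def poly_sum poly_monom sum_distrib_left
    proof (rule sum.cong[OF refl])
      fix i assume "i \<in> {..Polynomial.degree a}"
      then have "q ^ i \<le> Q"
        using q_gt_1 by (simp add: Q_def power_increasing)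
      then show "x ^ Q * (carlitz_coeff a i * (1 / x) ^ q ^ i) = carlitz_coeff a i * x ^ (Q - q ^ i)"
        using x(2) by (simp add: power_diff power_divide)
    qed
    ultimately show ?thesis
      using x(3) by (metis mult_zero_right nonzero_mult_div_cancel_right times_divide_eq_right mult.right_neutral)
  qed
  \<comment> \<open>From \<open>D(0) = 1\<close>; this keeps the division by the Carlitz polynomial
    at \<open>1 / x\<close> legitimate for small \<open>x\<close>.\<close>
  have D_neq: "\<exists>\<delta>>0. \<forall>x. nrm x < \<delta> \<longrightarrow> poly D x \<noteq> 0"
  proof (rule ccontr)
    assume "\<not> ?thesis"
    then have "\<exists>x. nrm x < \<delta> \<and> nrm (poly D x) < \<delta>" if "\<delta> > 0" for \<delta>
      using that by (metis dist_self)
    then have "poly D 0 = 0"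
      by (rule poly_0_eq_0)
    with D0 show False
      by simp
  qed
  then obtain \<delta>0 where \<delta>0: "\<delta>0 > 0" "\<And>x. nrm x < \<delta>0 \<Longrightarrow> poly D x \<noteq> 0"
    by blast
  show ?thesis
  proof (rule fps_ext)
    fix k
    \<comment> \<open>The coefficient \<open>k\<close> has to lie strictly below the truncation
      order.\<close>
    define N where "N = Suc k"
    define PN where "PN = (\<Sum>j<N. monom (fps_nth P j) j)"
    obtain z0 where z0: "generic z0" "t_param \<iota> \<pi> z0 \<noteq> 0" "nrm (t_param \<iota> \<pi> z0) < r"
      using small_t_param[OF \<pi> r(1)] .
    obtain M where M: "0 \<le> M"
      "\<And>x y. \<lbrakk>(\<lambda>k. fps_nth P k * x ^ k) sums y; nrm x \<le> nrm (t_param \<iota> \<pi> z0)\<rbrakk> \<Longrightarrow>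
        dist (\<Sum>k<N. fps_nth P k * x ^ k) y \<le> M * nrm x ^ N"
      using sums_tail_bound[where N = N, OF r(2)[OF generic_not_A[OF z0(1)] z0(3)] z0(2)] by blast
    have "Polynomial.coeff (PN * D - monom 1 Q) k = 0"
    proof (rule coeff_eq_0_of_bound)
      fix \<delta> :: real assume "\<delta> > 0"
      \<comment> \<open>The bounds serve in turn the required smallness of \<open>x\<close>, the
        bound on \<open>D\<close>, its nonvanishing, and the tail estimate based at
        \<open>z0\<close>.\<close>
      define \<delta>1 where "\<delta>1 = min (min \<delta> 1) (min \<delta>0 (nrm (t_param \<iota> \<pi> z0)))"
      have "\<delta>1 > 0"
        using \<open>\<delta> > 0\<close> \<delta>0(1) z0(2) by (simp add: \<delta>1_def)
      then obtain z where z: "generic z" "t_param \<iota> \<pi> z \<noteq> 0" "nrm (t_param \<iota> \<pi> z) < \<delta>1"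
        using small_t_param[OF \<pi>] by metis
      define x where "x = t_param \<iota> \<pi> z"
      define y where "y = t_param \<iota> \<pi> (of_A \<iota> a * z)"
      have x: "x \<noteq> 0" "nrm x < \<delta>" "nrm x \<le> 1" "nrm x < \<delta>0" "nrm x \<le> nrm (t_param \<iota> \<pi> z0)" "nrm x < r"
        using z z0(3) by (auto simp: x_def \<delta>1_def)
      have "(\<lambda>k. fps_nth P k * x ^ k) sums y"
        unfolding x_def y_def by (rule r(2)[OF generic_not_A[OF z(1)]]) (use x in \<open>simp add: x_def\<close>)
      then have "dist (poly PN x) y \<le> M * nrm x ^ N"
        using M(2) x(5) by (simp add: PN_def poly_sum poly_monom)
      then have "nrm (poly PN x - y) \<le> M * nrm x ^ N"
        using dist_diff[of "poly PN x" y] by simp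
      then have "nrm (poly D x) * nrm (poly PN x - y) \<le> BD * (M * nrm x ^ N)"
        using BD x(3) by (intro mult_mono) auto
      moreover have "poly (PN * D - monom 1 Q) x = poly D x * (poly PN x - y)"
        using D_t[OF x_def x(1) \<delta>0(2)[OF x(4)]] by (simp add: y_def poly_monom algebra_simps)
      ultimately have "nrm (poly (PN * D - monom 1 Q) x) \<le> BD * M * nrm x ^ N"
        by (simp add: abs_mult mult.assoc)
      with x show "\<exists>x. x \<noteq> 0 \<and> nrm x < \<delta> \<and> nrm (poly (PN * D - monom 1 Q) x) \<le> BD * M * nrm x ^ N"
        by blast
    qed (use BD(1) M(1) in \<open>auto simp: N_def\<close>)
    moreover have "Polynomial.coeff (PN * D) k = fps_nth (P * t_denom a) k"
      unfolding Polynomial.coeff_mult fps_mult_nth D PN_def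
      by (auto simp: coeff_sum N_def atLeast0AtMost intro!: sum.cong)
    ultimately show "fps_nth (P * t_denom a) k = fps_nth (fps_X ^ q ^ Polynomial.degree a) k"
      by (simp add: Q_def[symmetric] fps_X_power_nth)
  qed
qed

end

section \<open>Passage from the analytic data to the formal independence result\<close>

theorem theorem2p2:
  fixes \<iota> :: "'f::{finite,field} fls alg_closure \<Rightarrow> 'c::{field,complete_space}"
    and \<pi> :: 'c
    and n :: nat
    and G :: "'c poly"
    and t :: "'f poly \<Rightarrow> 'c fps"
    and c c' :: "'f poly \<Rightarrow> 'c"
  assumes "C_infty \<iota>"
    and "carlitz_period \<iota> \<pi>"
    and "n > 0"
    and "is_goss_poly \<iota> \<pi> n G"
    and "\<And>a. a \<in> A_plus \<Longrightarrow> is_t_expansion \<iota> \<pi> a (t a)"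
    and "A_expansion t G c = A_expansion t G c'"
  shows "\<forall>a\<in>A_plus \<union> {0}. c a = c' a"
proof -
  interpret C_infty \<iota>
    by fact
  have \<pi>: "\<pi> \<noteq> 0"
    using assms(2) by (simp add: carlitz_period_def)
  have t: "t a * t_denom a = fps_X ^ q ^ Polynomial.degree a" if "a \<in> A_plus" for a
    using t_expansion_eq[OF assms(2) that assms(5)[OF that]] .
  have G0: "Polynomial.coeff G 0 = 0"
    using goss_poly_0[OF \<pi> assms(3,4)] by (simp add: poly_0_coeff_0)
  have deg: "k < q ^ k" for k
    using q_gt_1 by (simp add: power_gt_expt)
  have Gt: "poly (map_poly fps_const G) (t a) = fps_of_poly G oo t a" if "a \<in> A_plus" for a
    by (rule poly_map_fps_const) (rule t_nth_0[OF that t[OF that]])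
  have Gt_nth: "fps_nth (fps_of_poly G oo t a) k = 0" if "a \<in> A_plus" "k < Polynomial.degree a" for a k
    unfolding fps_compose_nth
  proof (rule sum.neutral, rule ballI)
    fix i
    show "fps_nth (fps_of_poly G) i * fps_nth (t a ^ i) k = 0"
    proof (cases "i = 0")
      case False
      then have "q ^ Polynomial.degree a * 1 \<le> q ^ Polynomial.degree a * i"
        by (intro mult_le_mono2) auto
      with that deg[of "Polynomial.degree a"] have "k < q ^ Polynomial.degree a * i"
        by linarith
      then show ?thesis
        using t_power_nth(1)[OF that(1) t[OF that(1)]] by simp
    qed (simp add: G0)
  qed
  have nth: "fps_nth (A_expansion t G d) k = (if k = 0 then d 0 else 0) +
      (\<Sum>a | a \<in> A_plus \<and> Polynomial.degree a \<le> k. d a * fps_nth (fps_of_poly G oo t a) k)" for d k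
  proof -
    have "fps_nth (\<Sum>\<^sub>\<infinity>a\<in>A_plus. fps_const (d a) * poly (map_poly fps_const G) (t a)) k =
        (\<Sum>a | a \<in> A_plus \<and> Polynomial.degree a \<le> k.
          fps_nth (fps_const (d a) * poly (map_poly fps_const G) (t a)) k)"
      by (rule infsum_fps_nth) (simp add: Gt Gt_nth)
    then show ?thesis
      by (simp add: A_expansion_def Gt)
  qed
  have diff: "(if k = 0 then c 0 - c' 0 else 0) +
      (\<Sum>a | a \<in> A_plus \<and> Polynomial.degree a \<le> k. (c a - c' a) * fps_nth (fps_of_poly G oo t a) k) = 0" for k
    using arg_cong[OF assms(6), of "\<lambda>f. fps_nth f k"]
    by (simp add: nth left_diff_distrib sum_subtractf algebra_simps split: if_splits)
  \<comment> \<open>As \<open>G(0) = 0\<close>, no \<open>G(t_a)\<close> has a constant term, so the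
    coefficient 0 compares only \<open>c 0\<close> and \<open>c' 0\<close>.\<close>
  have c0: "c 0 = c' 0"
    using diff[of 0] by (simp add: G0)
  have "\<forall>a\<in>A_plus. c a - c' a = 0"
  proof (rule A_expansion_independent[OF t])
    show "fps_nth (fps_of_poly G) (Polynomial.degree G) \<noteq> 0"
      using goss_poly_neq_0[OF \<pi> assms(3,4)] by simp
    show "(\<Sum>a | a \<in> A_plus \<and> Polynomial.degree a \<le> k. (c a - c' a) * fps_nth (fps_of_poly G oo t a) k) = 0" for k
      using diff[of k] c0 by (simp split: if_splits)
  qed (auto simp: G0 coeff_eq_0)
  with c0 show ?thesis
    by auto
qed

end
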